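(* Let $m,s$ be positive integers such that $s\geq 2$ and $m\geq 6s$. Let $\mathcal{X}=\{x_k\}_{k=1}^s\subseteq\mathbb{T}$ be a set of $s$ distinct points, and let $\tau\in(0,\frac12]$ be any number such that $\mathcal{X}$ satisfies the $(m,\tau)$ density criterion, i.e. $\frac{3\nu(\tau,\mathcal{X})}{\tau}\leq m$. For each $k=1,\dots,s$, define $$\mathcal{G}_k:=\mathcal{G}(x_k,\tau,\mathcal{X}),\qquad \alpha_k:=\frac{|\mathcal{B}(x_k,\tau,\mathcal{X})|}{2m-4\nu(\tau,\mathcal{G}_k)\tau^{-1}},$$ and the subsets $$\mathcal{I}_k:=\{x\in\mathcal{X}\colon 0<|x-x_k|_{\mathbb{T}}\leq\alpha_k\},\qquad \mathcal{J}_k:=\{x\in\mathcal{X}\colon \alpha_k<|x-x_k|_{\mathbb{T}}\leq\tau\}.$$ Then $$\frac{1}{\sigma_s^2(\Phi(m,\mathcal{X}))}\leq\sum_{k=1}^s 2^{\nu(\tau,\mathcal{G}_k)}\,\frac{2\alpha_k}{1-2\alpha_k}\prod_{x\in\mathcal{J}_k}\phi\left(\frac{1}{2|x-x_k|_{\mathbb{T}}}\right)^2\prod_{x\in\mathcal{I}_k}\frac{\alpha_k^2}{(1-2\alpha_k)^2|x-x_k|_{\mathbb{T}}^2},$$ and in particular, $$\sigma_s(\Phi(m,\mathcal{X}))\geq\min_{1\leq k\leq s}\left\{\frac{1}{\sqrt{4s\alpha_k}}\,\frac{1}{\sqrt{2^{\nu(\tau,\mathcal{G}_k)}}}\,\f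rac{1}{2^{|\mathcal{J}_k|}}\prod_{x\in\mathcal{I}_k}\frac{|x-x_k|_{\mathbb{T}}}{2\alpha_k}\right\}.$$
   Context: $\mathbb{T}:=\mathbb{R}/\mathbb{Z}$ and $|t|_{\mathbb{T}}:=\min_{n\in\mathbb{Z}}|t-n|$. For a set $\mathcal{X}=\{x_k\}_{k=1}^s\subseteq\mathbb{T}$ of cardinality $s$ and an integer $m\geq s$, the Fourier matrix is the $m\times s$ matrix $\Phi(m,\mathcal{X}):=[e^{-2\pi i j x_k}]_{j=0,\dots,m-1,\;k=1,\dots,s}$, and $\sigma_k(\Phi)$ denotes its $k$-th largest singular value, so $\sigma_s$ is the smallest. For $\tau\in(0,\frac12]$ and a finite set $\mathcal{U}\subseteq\mathbb{T}$, the $\tau$ local sparsity is $\nu(\tau,\mathcal{U}):=\max_{u\in\mathcal{U}}|\{u'\in\mathcal{U}\colon|u-u'|_{\mathbb{T}}\leq\tau\}|$, with $\nu(\tau,\emptyset):=0$. For $x\in\mathcal{X}$, $\mathcal{B}(x,\tau,\mathcal{X}):=\{x'\in\mathcal{X}\colon|x-x'|_{\mathbb{T}}\leq\tau\}$ and $\mathcal{G}(x,\tau,\mathcal{X}):=\{x'\in\mathcal{X}\colon|x-x'|_{\mathbb{T}}>\tau\}$. The function $\phi\colon[1,\infty)\to[1,\infty)$ is $\phi(t):=t/\lfloor t\rfloor$. A product over an empty set equals $1$. *)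

theory Defs
  imports
    Complex_Main
    "HOL-Computational_Algebra.Fundamental_Theorem_Algebra"
    "Jordan_Normal_Form.Char_Poly"
    "Jordan_Normal_Form.Schur_Decomposition"
begin

quotient_type torus = real / "\<lambda>x y :: real. x - y \<in> \<int>"
proof (rule equivpI)
  show "reflp (\<lambda>x y :: real. x - y \<in> \<int>)"
    by (simp add: reflp_def)
  show "symp (\<lambda>x y :: real. x - y \<in> \<int>)"
    by (metis (no_types, lifting) Ints_minus minus_diff_eq sympI)
  show "transp (\<lambda>x y :: real. x - y \<in> \<int>)"
  proof (rule transpI)
    fix x y z :: real
    assume "x - y \<in> \<int>" "y - z \<in> \<int>"
    then have "(x - y) + (y - z) \<in> \<int>" by (rule Ints_add)
    then show "x - z \<in> \<int>" by simp
  qed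
qed

instantiation torus :: ab_group_add
begin

lift_definition zero_torus :: torus is "0 :: real" .

lift_definition plus_torus :: "torus \<Rightarrow> torus \<Rightarrow> torus" is "(+) :: real \<Rightarrow> real \<Rightarrow> real"
  by (metis Ints_add add_diff_add)

lift_definition minus_torus :: "torus \<Rightarrow> torus \<Rightarrow> torus" is "(-) :: real \<Rightarrow> real \<Rightarrow> real"
proof -
  fix a b c d :: real
  assume "a - b \<in> \<int>" "c - d \<in> \<int>"
  then have "(a - b) - (c - d) \<in> \<int>" by (rule Ints_diff)
  then show "a - c - (b - d) \<in> \<int>" by (simp add: algebra_simps)
qed

lift_definition uminus_torus :: "torus \<Rightarrow> torus" is "uminus :: real \<Rightarrow> real"
  by (metis Ints_minus minus_diff_minus)

instance
  by standard (transfer, simp add: algebra_simps)+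

end

text \<open>The minimum over all integers is rendered as an infimum, which is attained
  (lemma \<open>torus_abs_attained\<close>).\<close>

lift_definition torus_abs :: "torus \<Rightarrow> real" is "\<lambda>t :: real. INF n :: int. \<bar>t - of_int n\<bar>"
proof -
  fix t u :: real
  assume "t - u \<in> \<int>"
  then obtain k :: int where k: "t = u + of_int k"
    by (metis Ints_cases add.commute diff_add_cancel)
  have "range (\<lambda>n :: int. \<bar>t - of_int n\<bar>) = range (\<lambda>n :: int. \<bar>u - of_int n\<bar>)"
  proof (intro equalityI subsetI)
    fix y assume "y \<in> range (\<lambda>n :: int. \<bar>t - of_int n\<bar>)"
    then obtain n :: int where "y = \<bar>t - of_int n\<bar>" by blast
    then have "y = \<bar>u - of_int (n - k)\<bar>" using k by simp
    then show "y \<in> range (\<lambda>n :: int. \<bar>u - of_int n\<bar>)" by blast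
  next
    fix y assume "y \<in> range (\<lambda>n :: int. \<bar>u - of_int n\<bar>)"
    then obtain n :: int where "y = \<bar>u - of_int n\<bar>" by blast
    then have "y = \<bar>t - of_int (n + k)\<bar>" using k by simp
    then show "y \<in> range (\<lambda>n :: int. \<bar>t - of_int n\<bar>)" by blast
  qed
  then show "(INF n :: int. \<bar>t - of_int n\<bar>) = (INF n :: int. \<bar>u - of_int n\<bar>)" by simp
qed

lemma torus_abs_attained:
  "(\<exists>n :: int. torus_abs (abs_torus t) = \<bar>t - of_int n\<bar>)
   \<and> (\<forall>n :: int. torus_abs (abs_torus t) \<le> \<bar>t - of_int n\<bar>)"
proof -
  have bdd: "bdd_below (range (\<lambda>n :: int. \<bar>t - of_int n\<bar>))"
    by (rule bdd_belowI2[where m = 0]) simp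
  have le: "torus_abs (abs_torus t) \<le> \<bar>t - of_int n\<bar>" for n :: int
    unfolding torus_abs.abs_eq using bdd by (rule cINF_lower) simp
  have round: "\<bar>t - of_int (round t)\<bar> \<le> \<bar>t - of_int n\<bar>" for n :: int
    by (rule round_diff_minimal)
  have "\<bar>t - of_int (round t)\<bar> \<le> torus_abs (abs_torus t)"
    unfolding torus_abs.abs_eq by (rule cINF_greatest) (simp_all add: round)
  with le show ?thesis by (meson order_antisym)
qed

lift_definition torus_exp :: "nat \<Rightarrow> torus \<Rightarrow> complex"
  is "\<lambda>j x. exp (- 2 * complex_of_real pi * \<i> * of_nat j * complex_of_real x)"
proof -
  fix j :: nat and x y :: real
  assume "x - y \<in> \<int>"
  then obtain k :: int where k: "x = y + of_int k"
    by (metis Ints_cases add.commute diff_add_cancel)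
  have "- 2 * complex_of_real pi * \<i> * of_nat j * complex_of_real x
      = - 2 * complex_of_real pi * \<i> * of_nat j * complex_of_real y
        + complex_of_real (2 * real_of_int (- (int j * k)) * pi) * \<i>"
    by (simp add: k algebra_simps)
  moreover have "exp (complex_of_real (2 * real_of_int (- (int j * k)) * pi) * \<i>) = 1"
    by (subst mult.commute, subst cis_conv_exp[symmetric])
       (metis Ints_of_int cis_multiple_2pi mult.assoc mult.commute)
  ultimately show "exp (- 2 * complex_of_real pi * \<i> * of_nat j * complex_of_real x)
      = exp (- 2 * complex_of_real pi * \<i> * of_nat j * complex_of_real y)"
    by (simp only: exp_add mult_1_right)
qed

text \<open>The points are enumerated from 1, the matrix columns from 0.\<close>

definition fourier_matrix :: "nat \<Rightarrow> nat \<Rightarrow> (nat \<Rightarrow> torus) \<Rightarrow> complex mat" where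
  "fourier_matrix m s x = mat m s (\<lambda>(j, k). torus_exp j (x (k + 1)))"

text \<open>\<open>sing_val k A\<close> is the \<open>k\<close>-th largest singular value for \<open>1 \<le> k \<le> min (dim_row A) (dim_col A)\<close>:
  the eigenvalues of \<open>A\<^sup>* A\<close>, which are real and nonnegative, are counted with algebraic
  multiplicity as roots of the characteristic polynomial.\<close>

definition sing_vals :: "complex mat \<Rightarrow> real list" where
  "sing_vals A = rev (sorted_list_of_multiset
     (image_mset (\<lambda>z. sqrt (Re z)) (proots (char_poly (mat_adjoint A * A)))))"

definition sing_val :: "nat \<Rightarrow> complex mat \<Rightarrow> real" where
  "sing_val k A = sing_vals A ! (k - 1)"

definition local_sparsity :: "real \<Rightarrow> torus set \<Rightarrow> nat" where
  "local_sparsity \<tau> U =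
     (if U = {} then 0 else Max ((\<lambda>u. card {u' \<in> U. torus_abs (u - u') \<le> \<tau>}) ` U))"

definition bad_set :: "torus \<Rightarrow> real \<Rightarrow> torus set \<Rightarrow> torus set" where
  "bad_set x \<tau> X = {x' \<in> X. torus_abs (x - x') \<le> \<tau>}"

definition good_set :: "torus \<Rightarrow> real \<Rightarrow> torus set \<Rightarrow> torus set" where
  "good_set x \<tau> X = {x' \<in> X. torus_abs (x - x') > \<tau>}"

text \<open>Only used for arguments \<open>t \<ge> 1\<close>.\<close>

definition phi :: "real \<Rightarrow> real" where
  "phi t = t / of_int \<lfloor>t\<rfloor>"

end

theory Submission
  imports "HOL-Analysis.Gamma_Function" Defs
begin

unbundle no vec_syntax

text \<open>If polynomials \<open>f k\<close> of degree less than \<open>m\<close> satisfy \<open>f k (z l) = \<delta> k l\<close> at the nodes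
  \<open>z l = exp (- 2 \<pi> i x l)\<close>, then their coefficients form a left inverse of the Fourier matrix, so
  \<open>1 / \<sigma>\<^sup>2\<close> is at most the sum of the squared \<open>l\<^sup>2\<close> norms of the coefficient vectors.

  Each \<open>f k\<close> is a normalised Dirichlet kernel times a factor of small sup norm vanishing at the other
  points. A point at distance \<open>t \<le> \<tau>\<close> is removed by \<open>(z ^ n - w ^ n) / (z k ^ n - w ^ n)\<close> with
  \<open>n\<close> as close to \<open>1 / (2 t)\<close> as the degree budget \<open>1 / (2 \<alpha> k)\<close> per point allows. The points further
  away than \<open>\<tau>\<close> are greedily split into \<open>\<nu>\<close> classes that are \<open>\<tau>\<close>-separated; each class is removed by a
  minimal-norm interpolant of degree at most \<open>2 / \<tau>\<close>, whose sup norm is at most \<open>\<surd>2\<close> by the lower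
  bound \<open>n - 1 / \<tau>\<close> for the squared smallest singular value with \<open>n\<close> rows. That bound follows from the
  Montgomery--Vaughan form of Hilbert's inequality.\<close>

section \<open>Hilbert's inequality\<close>

text \<open>The proof is an allocation of degrees. Removing the far points costs degree
  \<open>2 * \<nu> / \<tau>\<close>; the rest of \<open>m\<close> is shared equally by the points
  within \<tau> of \<open>x k\<close>, including \<open>x k\<close> itself, whose share goes to the
  Dirichlet kernel. One share is \<open>1 / (2 * \<alpha> k)\<close>, which explains the formula for
  \<open>\<alpha> k\<close>. A factor of degree \<open>n\<close> for a point at distance
  \<open>t\<close> has a denominator of modulus \<open>2 * sin (pi * n * t)\<close>, largest at
  \<open>n * t = 1 / 2\<close>: degree beyond \<open>1 / (2 * t)\<close> buys nothing, whereas for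
  \<open>t < \<alpha> k\<close> the share runs out first. This separates \<open>J k\<close>, where
  only the rounding loss \<open>phi\<close> is paid, from \<open>I k\<close>, where the factor grows
  like \<open>\<alpha> k / t\<close>. The density criterion leaves at least
  \<open>\<nu> / \<tau>\<close> degrees for the near points and so keeps \<open>\<alpha> k\<close>
  at most 1/4. The delicate constant is that of Hilbert's inequality: the base 2 in
  \<open>2 ^ \<nu>\<close> is a bound for the quotient of \<open>n\<close> by the frame bound
  \<open>n - 1 / \<tau>\<close> at \<open>n\<close> about \<open>2 / \<tau>\<close>, so
  \<open>1 / \<delta>\<close> has to come out without an extra factor.\<close>

text \<open>No spectral theorem is needed: with \<open>F k\<close> the squared Frobenius norm of \<open>H ^ k\<close>, summing the
  hypothesis over the columns of \<open>H ^ k\<close> gives \<open>F (k + 1) \<le> L * F k\<close>, because the diagonal of an odd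
  power of a skew-symmetric matrix vanishes and kills the \<open>C\<close> term. Log-convexity of
  \<open>b k = \<parallel>H ^ k u\<parallel>\<^sup>2\<close> turns this geometric growth rate into a bound on \<open>b 1 / b 0\<close>.\<close>

lemma skew_symmetric_operator_bound:
  fixes H :: "'a \<Rightarrow> 'a \<Rightarrow> real" and C :: "'a \<Rightarrow> real"
  assumes fin: "finite W" and skew: "\<And>a b. H a b = - H b a"
    and step: "\<And>u. (\<Sum>t\<in>W. (\<Sum>r\<in>W. H t r * u r)\<^sup>2)
      \<le> L * (\<Sum>t\<in>W. (u t)\<^sup>2) - 2 * (\<Sum>t\<in>W. C t * u t * (\<Sum>r\<in>W. H t r * u r))"
    and L: "0 \<le> L"
  shows "(\<Sum>t\<in>W. (\<Sum>r\<in>W. H t r * u r)\<^sup>2) \<le> L * (\<Sum>t\<in>W. (u t)\<^sup>2)"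
proof -
  define T where "T = (\<lambda>u t. \<Sum>r\<in>W. H t r * u r)"
  define e where "e = (\<lambda>w r :: 'a. if r = w then 1 else 0 :: real)"
  define P where "P = (\<lambda>k w. (T ^^ k) (e w))"
  define b where "b = (\<lambda>k. \<Sum>t\<in>W. ((T ^^ k) u t)\<^sup>2)"
  define F where "F = (\<lambda>k. \<Sum>w\<in>W. \<Sum>t\<in>W. (P k w t)\<^sup>2)"
  have T_adj: "(\<Sum>t\<in>W. T v t * w t) = - (\<Sum>t\<in>W. v t * T w t)" for v w
  proof -
    have "(\<Sum>t\<in>W. T v t * w t) = (\<Sum>t\<in>W. \<Sum>r\<in>W. H t r * v r * w t)"
      by (simp add: T_def sum_distrib_right)
    also have "\<dots> = (\<Sum>r\<in>W. \<Sum>t\<in>W. H t r * v r * w t)"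
      by (rule sum.swap)
    also have "\<dots> = (\<Sum>r\<in>W. \<Sum>t\<in>W. - (H r t * v r * w t))"
    proof (intro sum.cong refl)
      fix r t show "H t r * v r * w t = - (H r t * v r * w t)" by (subst skew) simp
    qed
    also have "\<dots> = - (\<Sum>t\<in>W. v t * T w t)"
      by (simp add: T_def sum_distrib_left sum_negf mult_ac)
    finally show ?thesis .
  qed
  have lin: "(T ^^ k) v t = (\<Sum>w\<in>W. v w * P k w t)" if "t \<in> W" for k v t
    using that
  proof (induction k arbitrary: t)
    case 0
    have "(\<Sum>w\<in>W. v w * P 0 w t) = (\<Sum>w\<in>W. if t = w then v w else 0)"
      by (intro sum.cong) (auto simp: P_def e_def)
    with 0 fin show ?case by simp
  next
    case (Suc k)
    have "(T ^^ Suc k) v t = (\<Sum>r\<in>W. H t r * (T ^^ k) v r)"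
      by (simp add: T_def)
    also have "\<dots> = (\<Sum>r\<in>W. \<Sum>w\<in>W. v w * (H t r * P k w r))"
      using Suc.IH by (simp add: sum_distrib_left mult_ac)
    also have "\<dots> = (\<Sum>w\<in>W. v w * (\<Sum>r\<in>W. H t r * P k w r))"
      by (subst sum.swap) (simp add: sum_distrib_left)
    finally show ?case by (simp add: P_def T_def)
  qed
  have diag: "(\<Sum>w\<in>W. P k w t * P (Suc k) w t) = 0" if t: "t \<in> W" for k t
  proof -
    have "P (Suc k) w t = T (\<lambda>l. - P k l t) w" if "w \<in> W" for w
    proof -
      \<comment> \<open>The additional factor is applied to the unit vector rather than to the
        result. Skew symmetry then makes it act as \<open>- T\<close> on the starting index
        \<open>w\<close>, and the sum becomes a form \<open><v, T v>\<close>, which is its own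
        negative by \<open>T_adj\<close>.\<close>
      have "P (Suc k) w t = (T ^^ k) (T (e w)) t"
        unfolding P_def by (simp add: funpow_swap1)
      also have "\<dots> = (\<Sum>l\<in>W. T (e w) l * P k l t)"
        using t by (rule lin)
      also have "\<dots> = (\<Sum>l\<in>W. H w l * - P k l t)"
      proof (intro sum.cong refl)
        fix l assume "l \<in> W"
        have "T (e w) l = (\<Sum>r\<in>W. if r = w then H l r else 0)"
          unfolding T_def e_def by (intro sum.cong) auto
        also have "\<dots> = H l w" using fin that by simp
        finally show "T (e w) l * P k l t = H w l * - P k l t" by (subst skew) simp
      qed
      finally show ?thesis by (simp add: T_def)
    qed
    then have "(\<Sum>w\<in>W. P k w t * P (Suc k) w t) = (\<Sum>w\<in>W. P k w t * T (\<lambda>l. - P k l t) w)"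
      by (intro sum.cong) auto
    moreover have "T (\<lambda>l. - P k l t) w = - T (\<lambda>l. P k l t) w" for w
      by (simp add: T_def sum_negf)
    ultimately show ?thesis
      using T_adj[of "\<lambda>l. P k l t" "\<lambda>l. P k l t"] by (simp add: sum_negf mult.commute)
  qed
  have F_step: "F (Suc k) \<le> L * F k" for k
  proof -
    have "F (Suc k) \<le> (\<Sum>w\<in>W. L * (\<Sum>t\<in>W. (P k w t)\<^sup>2) - 2 * (\<Sum>t\<in>W. C t * P k w t * P (Suc k) w t))"
      unfolding F_def by (intro sum_mono) (use step in \<open>auto simp: P_def T_def\<close>)
    also have "\<dots> = L * F k - 2 * (\<Sum>w\<in>W. \<Sum>t\<in>W. C t * (P k w t * P (Suc k) w t))"
      by (simp add: F_def sum_subtractf sum_distrib_left mult_ac)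
    also have "(\<Sum>w\<in>W. \<Sum>t\<in>W. C t * (P k w t * P (Suc k) w t)) = 0"
      by (subst sum.swap) (simp add: sum_distrib_left[symmetric] diag)
    finally show ?thesis by simp
  qed
  have F_le: "F k \<le> L ^ k * F 0" for k
  proof (induction k)
    case (Suc k)
    have "F (Suc k) \<le> L * F k" by (rule F_step)
    also have "\<dots> \<le> L * (L ^ k * F 0)" using Suc L by (rule mult_left_mono)
    finally show ?case by simp
  qed simp
  have b_le: "b k \<le> b 0 * (L ^ k * F 0)" for k
  proof -
    have "b k \<le> (\<Sum>t\<in>W. (\<Sum>w\<in>W. (u w)\<^sup>2) * (\<Sum>w\<in>W. (P k w t)\<^sup>2))"
      unfolding b_def
    proof (intro sum_mono)
      fix t assume "t \<in> W"
      show "((T ^^ k) u t)\<^sup>2 \<le> (\<Sum>w\<in>W. (u w)\<^sup>2) * (\<Sum>w\<in>W. (P k w t)\<^sup>2)"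
        unfolding lin[OF \<open>t \<in> W\<close>] by (rule Cauchy_Schwarz_ineq_sum)
    qed
    also have "\<dots> = b 0 * (\<Sum>t\<in>W. \<Sum>w\<in>W. (P k w t)\<^sup>2)"
      by (simp add: b_def sum_distrib_left)
    also have "\<dots> = b 0 * F k" unfolding F_def by (subst sum.swap) simp
    also have "\<dots> \<le> b 0 * (L ^ k * F 0)"
      by (intro mult_left_mono F_le) (simp add: b_def sum_nonneg)
    finally show ?thesis .
  qed
  have b_nonneg: "0 \<le> b k" for k by (simp add: b_def sum_nonneg)
  have logconvex: "(b (Suc k))\<^sup>2 \<le> b k * b (Suc (Suc k))" for k
  proof -
    have "b (Suc k) = - (\<Sum>t\<in>W. (T ^^ k) u t * (T ^^ Suc (Suc k)) u t)"
      using T_adj[of "(T ^^ k) u" "(T ^^ Suc k) u"] by (simp add: b_def power2_eq_square)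
    then show ?thesis
      using Cauchy_Schwarz_ineq_sum[of "(T ^^ k) u" "(T ^^ Suc (Suc k)) u" W] by (simp add: b_def)
  qed
  \<comment> \<open>This is \<open>b 1 / b 0 \<le> b (Suc k) / b k\<close> with denominators
    cleared, because \<open>b k\<close> may vanish.\<close>
  have ratio: "b 1 * b k \<le> b 0 * b (Suc k)" for k
  proof (induction k)
    case (Suc k)
    show ?case
    proof (cases "b (Suc k) = 0")
      case False
      then have pos: "0 < b (Suc k)" using b_nonneg[of "Suc k"] by simp
      have "b 1 * b (Suc k) * b (Suc k) \<le> b 1 * (b k * b (Suc (Suc k)))"
        using mult_left_mono[OF logconvex[of k] b_nonneg[of 1]] by (simp add: power2_eq_square mult_ac)
      also have "\<dots> \<le> (b 0 * b (Suc k)) * b (Suc (Suc k))"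
        using mult_right_mono[OF Suc b_nonneg[of "Suc (Suc k)"]] by (simp add: mult_ac)
      finally have "(b 1 * b (Suc k)) * b (Suc k) \<le> (b 0 * b (Suc (Suc k))) * b (Suc k)"
        by (simp add: mult_ac)
      then show ?thesis using pos by (simp only: mult_le_cancel_right_pos)
    qed (use b_nonneg in simp)
  qed simp
  have "b 1 \<le> L * b 0"
  proof (rule ccontr)
    assume "\<not> b 1 \<le> L * b 0"
    then have gt: "L * b 0 < b 1" by simp
    have b0: "0 < b 0"
    proof (rule ccontr)
      assume "\<not> 0 < b 0"
      then have "b 0 = 0" using b_nonneg[of 0] by simp
      then show False using gt b_le[of 1] by simp
    qed
    define q where "q = b 1 / b 0"
    have q: "L < q" using gt b0 by (simp add: q_def field_simps)
    have qk: "q ^ k * b 0 \<le> b k" for k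
    proof (induction k)
      case (Suc k)
      have "q ^ Suc k * b 0 = q * (q ^ k * b 0)" by simp
      also have "\<dots> \<le> q * b k" using Suc q L by (intro mult_left_mono) auto
      also have "\<dots> \<le> b (Suc k)" using ratio[of k] b0 by (simp add: q_def field_simps)
      finally show ?case .
    qed simp
    have le: "q ^ k \<le> L ^ k * F 0" for k
      using order_trans[OF qk b_le, of k] b0 by (simp add: mult.commute[of "b 0"])
    show False
    proof (cases "L = 0")
      case True
      then show False using le[of 1] q by simp
    next
      case False
      then have Lpos: "0 < L" using L by simp
      obtain k where "F 0 < (q / L) ^ k"
        using real_arch_pow[of "q / L" "F 0"] q Lpos by auto
      then show False using le[of k] Lpos by (simp add: power_divide field_simps)
    qed
  qed
  then show ?thesis by (simp add: b_def T_def)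
qed

text \<open>Since \<open>1 / 0 = 0\<close>, both kernels vanish on the diagonal, so sums over \<open>b \<noteq> a\<close> need no exclusion.\<close>

definition csc :: "real \<Rightarrow> real \<Rightarrow> real" where
  "csc a b = 1 / sin (pi * (a - b))"

definition cotd :: "real \<Rightarrow> real \<Rightarrow> real" where
  "cotd a b = cos (pi * (a - b)) / sin (pi * (a - b))"

lemma csc_self [simp]: "csc a a = 0" by (simp add: csc_def)

lemma cotd_self [simp]: "cotd a a = 0" by (simp add: cotd_def)

lemma csc_skew: "csc a b = - csc b a"
proof -
  have "sin (pi * (a - b)) = - sin (pi * (b - a))"
    by (metis minus_diff_eq mult_minus_right sin_minus)
  then show ?thesis by (simp add: csc_def)
qed

lemma cotd_skew: "cotd a b = - cotd b a"
proof -
  have "sin (pi * (a - b)) = - sin (pi * (b - a))" "cos (pi * (a - b)) = cos (pi * (b - a))"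
    by (metis minus_diff_eq mult_minus_right sin_minus, metis minus_diff_eq mult_minus_right cos_minus)
  then show ?thesis by (simp add: cotd_def)
qed

text \<open>Partial fractions: by the subtraction formula for the sine, a difference of two
  cotangents is a product of cosecants. Each resulting term depends on \<open>s\<close> through a
  single cotangent, so the sum over \<open>s\<close> in the Gram matrix separates.\<close>

lemma csc_mult_csc:
  assumes "sin (pi * (a - b)) \<noteq> 0" "sin (pi * (s - a)) \<noteq> 0" "sin (pi * (s - b)) \<noteq> 0"
  shows "csc s a * csc s b = csc a b * (cotd b s - cotd a s)"
proof -
  have "sin (pi * (a - b)) = sin (pi * (s - b) - pi * (s - a))" by (simp add: algebra_simps)
  also have "\<dots> = sin (pi * (s - b)) * cos (pi * (s - a)) - cos (pi * (s - b)) * sin (pi * (s - a))"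
    by (rule sin_diff)
  finally have "sin (pi * (a - b)) / (sin (pi * (s - a)) * sin (pi * (s - b))) = cotd s a - cotd s b"
    using assms by (simp add: cotd_def field_simps)
  then have "csc s a * csc s b = csc a b * (cotd s a - cotd s b)"
    using assms by (simp add: csc_def field_simps)
  then show ?thesis by (simp add: cotd_skew[of s])
qed

text \<open>The terms \<open>s = r\<close> and \<open>s = t\<close> vanish on the left, where a
  cosecant is 0 by convention, but not on the right. Completing the two cotangent sums to all of
  \<open>W\<close> therefore produces the correction \<open>2 * cotd r t\<close>.\<close>

lemma csc_gram:
  assumes fin: "finite W" and nz: "\<And>a b. a \<in> W \<Longrightarrow> b \<in> W \<Longrightarrow> a \<noteq> b \<Longrightarrow> sin (pi * (a - b)) \<noteq> 0"
    and r: "r \<in> W" and t: "t \<in> W" and ne: "r \<noteq> t"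
  shows "(\<Sum>s\<in>W. csc s r * csc s t)
    = csc r t * ((\<Sum>s\<in>W. cotd t s) - (\<Sum>s\<in>W. cotd r s) + 2 * cotd r t)"
proof -
  have split: "(\<Sum>s\<in>W. g s) = g r + g t + (\<Sum>s\<in>W - {r, t}. g s)" for g :: "real \<Rightarrow> real"
    using fin r t ne by (simp add: sum.remove[of W r] sum.remove[of "W - {r}" t] Diff_insert2[symmetric] insert_commute)
  have "(\<Sum>s\<in>W. csc s r * csc s t) = (\<Sum>s\<in>W - {r, t}. csc r t * (cotd t s - cotd r s))"
    using nz r t ne by (subst split) (auto intro!: sum.cong csc_mult_csc)
  also have "\<dots> = csc r t * ((\<Sum>s\<in>W - {r, t}. cotd t s) - (\<Sum>s\<in>W - {r, t}. cotd r s))"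
    by (simp add: sum_distrib_left[symmetric] sum_subtractf)
  finally show ?thesis
    using split[of "cotd t"] split[of "cotd r"] by (simp add: cotd_skew[of t r])
qed

text \<open>Bounding the cotangent row sums in absolute value would cost a logarithm. In the
  quadratic form their two occurrences combine to \<open>- 2 * <C u, H u>\<close>, exactly the term
  that \<open>skew_symmetric_operator_bound\<close> tolerates. What remains decays quadratically:
  the squared cosecants on the diagonal, and the correction term of \<open>csc_gram\<close>, split
  by \<open>2 * a * b \<le> a^2 + b^2\<close>.\<close>

lemma hilbert_inequality_weighted:
  assumes fin: "finite W" and nz: "\<And>a b. a \<in> W \<Longrightarrow> b \<in> W \<Longrightarrow> a \<noteq> b \<Longrightarrow> sin (pi * (a - b)) \<noteq> 0"
    and L: "\<And>a. a \<in> W \<Longrightarrow> (\<Sum>b\<in>W. (csc a b)\<^sup>2 + 2 * \<bar>csc a b * cotd a b\<bar>) \<le> L" and L0: "0 \<le> L"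
  shows "(\<Sum>t\<in>W. (\<Sum>r\<in>W. csc t r * u r)\<^sup>2) \<le> L * (\<Sum>t\<in>W. (u t)\<^sup>2)"
proof (rule skew_symmetric_operator_bound[where C = "\<lambda>t. \<Sum>s\<in>W. cotd t s"])
  show "csc a b = - csc b a" for a b by (rule csc_skew)
  fix u :: "real \<Rightarrow> real"
  define C where "C = (\<lambda>t. \<Sum>s\<in>W. cotd t s)"
  have cross: "(\<Sum>r\<in>W. \<Sum>t\<in>W. u r * u t * (csc r t * g t)) = - (\<Sum>t\<in>W. g t * u t * (\<Sum>r\<in>W. csc t r * u r))" for g
  proof -
    have "(\<Sum>r\<in>W. u r * u t * (csc r t * g t)) = - (g t * u t * (\<Sum>r\<in>W. csc t r * u r))" for t
      unfolding sum_distrib_left sum_negf[symmetric]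
      by (intro sum.cong refl) (subst csc_skew, simp)
    then show ?thesis by (subst sum.swap) (simp add: sum_negf)
  qed
  have cross2: "(\<Sum>r\<in>W. \<Sum>t\<in>W. u r * u t * (csc r t * g r)) = (\<Sum>t\<in>W. g t * u t * (\<Sum>r\<in>W. csc t r * u r))" for g
    by (simp add: sum_distrib_left mult_ac)
  have "(\<Sum>t\<in>W. (\<Sum>r\<in>W. csc t r * u r)\<^sup>2) = (\<Sum>s\<in>W. \<Sum>r\<in>W. \<Sum>t\<in>W. u r * u t * (csc s r * csc s t))"
    by (simp add: power2_eq_square sum_product mult_ac)
  also have "\<dots> = (\<Sum>r\<in>W. \<Sum>t\<in>W. u r * u t * (\<Sum>s\<in>W. csc s r * csc s t))"
  proof -
    have "(\<Sum>s\<in>W. \<Sum>t\<in>W. u r * u t * (csc s r * csc s t)) = (\<Sum>t\<in>W. u r * u t * (\<Sum>s\<in>W. csc s r * csc s t))" for r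
      by (subst sum.swap) (simp add: sum_distrib_left)
    then show ?thesis by (subst sum.swap) simp
  qed
  also have "\<dots> = (\<Sum>r\<in>W. \<Sum>t\<in>W. (if r = t then (u r)\<^sup>2 * (\<Sum>s\<in>W. (csc r s)\<^sup>2) else 0)
      + u r * u t * (csc r t * C t) - u r * u t * (csc r t * C r) + 2 * (u r * u t * (csc r t * cotd r t)))"
  proof (intro sum.cong refl)
    fix r t assume rt: "r \<in> W" "t \<in> W"
    show "u r * u t * (\<Sum>s\<in>W. csc s r * csc s t) = (if r = t then (u r)\<^sup>2 * (\<Sum>s\<in>W. (csc r s)\<^sup>2) else 0)
      + u r * u t * (csc r t * C t) - u r * u t * (csc r t * C r) + 2 * (u r * u t * (csc r t * cotd r t))"
    proof (cases "r = t")
      case True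
      moreover have "csc s r * csc s r = (csc r s)\<^sup>2" for s
        using csc_skew[of s r] by (simp add: power2_eq_square)
      ultimately show ?thesis by (simp add: power2_eq_square)
    next
      case False
      have gram: "(\<Sum>s\<in>W. csc s r * csc s t) = csc r t * (C t - C r + 2 * cotd r t)"
        unfolding C_def by (rule csc_gram[OF fin _ rt False]) (rule nz)
      show ?thesis unfolding gram using False by (simp add: algebra_simps)
    qed
  qed
  also have "\<dots> = (\<Sum>r\<in>W. (u r)\<^sup>2 * (\<Sum>s\<in>W. (csc r s)\<^sup>2))
     - 2 * (\<Sum>t\<in>W. C t * u t * (\<Sum>r\<in>W. csc t r * u r))
     + 2 * (\<Sum>r\<in>W. \<Sum>t\<in>W. u r * u t * (csc r t * cotd r t))"
    using fin by (simp add: sum.distrib sum_subtractf cross cross2 sum_distrib_left[symmetric])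
  finally have expand: "(\<Sum>t\<in>W. (\<Sum>r\<in>W. csc t r * u r)\<^sup>2) = (\<Sum>r\<in>W. (u r)\<^sup>2 * (\<Sum>s\<in>W. (csc r s)\<^sup>2))
     - 2 * (\<Sum>t\<in>W. C t * u t * (\<Sum>r\<in>W. csc t r * u r))
     + 2 * (\<Sum>r\<in>W. \<Sum>t\<in>W. u r * u t * (csc r t * cotd r t))" .
  have "2 * (\<Sum>r\<in>W. \<Sum>t\<in>W. u r * u t * (csc r t * cotd r t))
     \<le> (\<Sum>r\<in>W. \<Sum>t\<in>W. (u r)\<^sup>2 * \<bar>csc r t * cotd r t\<bar> + (u t)\<^sup>2 * \<bar>csc r t * cotd r t\<bar>)"
    unfolding sum_distrib_left
  proof (intro sum_mono)
    fix r t
    have "2 * (u r * u t * (csc r t * cotd r t)) \<le> 2 * \<bar>u r\<bar> * \<bar>u t\<bar> * \<bar>csc r t * cotd r t\<bar>"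
      using abs_ge_self[of "2 * (u r * u t * (csc r t * cotd r t))"] by (simp add: abs_mult)
    also have "\<dots> \<le> ((u r)\<^sup>2 + (u t)\<^sup>2) * \<bar>csc r t * cotd r t\<bar>"
      using sum_squares_bound[of "\<bar>u r\<bar>" "\<bar>u t\<bar>"] by (intro mult_right_mono) auto
    finally show "2 * (u r * u t * (csc r t * cotd r t)) \<le> (u r)\<^sup>2 * \<bar>csc r t * cotd r t\<bar> + (u t)\<^sup>2 * \<bar>csc r t * cotd r t\<bar>"
      by (simp add: algebra_simps)
  qed
  also have "\<dots> = (\<Sum>r\<in>W. (u r)\<^sup>2 * (\<Sum>t\<in>W. 2 * \<bar>csc r t * cotd r t\<bar>))"
  proof -
    have sym: "csc r t * cotd r t = csc t r * cotd t r" for r t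
      by (subst csc_skew, subst cotd_skew) (rule minus_mult_minus)
    have "(\<Sum>r\<in>W. \<Sum>t\<in>W. (u t)\<^sup>2 * \<bar>csc r t * cotd r t\<bar>) = (\<Sum>t\<in>W. \<Sum>r\<in>W. (u t)\<^sup>2 * \<bar>csc r t * cotd r t\<bar>)"
      by (rule sum.swap)
    also have "\<dots> = (\<Sum>t\<in>W. \<Sum>r\<in>W. (u t)\<^sup>2 * \<bar>csc t r * cotd t r\<bar>)"
      by (intro sum.cong refl) (simp only: sym)
    finally have swap: "(\<Sum>r\<in>W. \<Sum>t\<in>W. (u t)\<^sup>2 * \<bar>csc r t * cotd r t\<bar>)
        = (\<Sum>r\<in>W. \<Sum>t\<in>W. (u r)\<^sup>2 * \<bar>csc r t * cotd r t\<bar>)" .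
    have "(\<Sum>r\<in>W. \<Sum>t\<in>W. (u r)\<^sup>2 * \<bar>csc r t * cotd r t\<bar> + (u t)\<^sup>2 * \<bar>csc r t * cotd r t\<bar>)
        = 2 * (\<Sum>r\<in>W. \<Sum>t\<in>W. (u r)\<^sup>2 * \<bar>csc r t * cotd r t\<bar>)"
      unfolding sum.distrib swap by simp
    then show ?thesis by (simp add: sum_distrib_left mult_ac)
  qed
  finally have "(\<Sum>t\<in>W. (\<Sum>r\<in>W. csc t r * u r)\<^sup>2) + 2 * (\<Sum>t\<in>W. C t * u t * (\<Sum>r\<in>W. csc t r * u r))
    \<le> (\<Sum>r\<in>W. (u r)\<^sup>2 * (\<Sum>s\<in>W. (csc r s)\<^sup>2)) + (\<Sum>r\<in>W. (u r)\<^sup>2 * (\<Sum>t\<in>W. 2 * \<bar>csc r t * cotd r t\<bar>))"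
    unfolding expand by simp
  also have "\<dots> = (\<Sum>r\<in>W. (u r)\<^sup>2 * (\<Sum>s\<in>W. (csc r s)\<^sup>2 + 2 * \<bar>csc r s * cotd r s\<bar>))"
    by (simp add: sum.distrib distrib_left)
  also have "\<dots> \<le> (\<Sum>r\<in>W. (u r)\<^sup>2 * L)"
    by (intro sum_mono mult_left_mono L) auto
  also have "\<dots> = L * (\<Sum>t\<in>W. (u t)\<^sup>2)"
    by (simp add: sum_distrib_left mult.commute)
  finally show "(\<Sum>t\<in>W. (\<Sum>r\<in>W. csc t r * u r)\<^sup>2) \<le> L * (\<Sum>t\<in>W. (u t)\<^sup>2)
      - 2 * (\<Sum>t\<in>W. (\<Sum>s\<in>W. cotd t s) * u t * (\<Sum>r\<in>W. csc t r * u r))"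
    by (simp add: C_def)
qed (use fin L0 in auto)

section \<open>Trigonometric bounds and inverse square sums over separated points\<close>

lemma sin_ge_cubic: "y - y ^ 3 / 6 \<le> sin y" if "0 \<le> y" for y :: real
proof -
  have cos_ge: "1 - x\<^sup>2 / 2 \<le> cos x" if "0 \<le> x" for x :: real
  proof -
    have "(sin (x / 2))\<^sup>2 \<le> (x / 2)\<^sup>2"
      using abs_sin_x_le_abs_x by (metis abs_le_square_iff)
    moreover have "cos x = 1 - 2 * (sin (x / 2))\<^sup>2"
      using cos_double_sin[of "x / 2"] by simp
    ultimately show ?thesis by (simp add: power2_eq_square)
  qed
  have "sin 0 - (0 - 0 ^ 3 / 6) \<le> sin y - (y - y ^ 3 / 6)"
  proof (rule DERIV_nonneg_imp_nondecreasing[OF that])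
    fix x :: real assume "0 \<le> x" "x \<le> y"
    then show "\<exists>d. ((\<lambda>x. sin x - (x - x ^ 3 / 6)) has_real_derivative d) (at x) \<and> 0 \<le> d"
      using cos_ge[of x]
      by (intro exI[of _ "cos x - (1 - x\<^sup>2 / 2)"] conjI) (auto intro!: derivative_eq_intros)
  qed
  then show ?thesis by simp
qed

lemma cos_le_quartic: "cos y \<le> 1 - y\<^sup>2 / 2 + y ^ 4 / 24" if "0 \<le> y" for y :: real
proof -
  have "(1 - 0\<^sup>2 / 2 + 0 ^ 4 / 24) - cos 0 \<le> (1 - y\<^sup>2 / 2 + y ^ 4 / 24) - cos y"
  proof (rule DERIV_nonneg_imp_nondecreasing[OF that])
    fix x :: real assume "0 \<le> x" "x \<le> y"
    then show "\<exists>d. ((\<lambda>x. (1 - x\<^sup>2 / 2 + x ^ 4 / 24) - cos x) has_real_derivative d) (at x) \<and> 0 \<le> d"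
      using sin_ge_cubic[of x]
      by (intro exI[of _ "sin x - (x - x ^ 3 / 6)"] conjI) (auto intro!: derivative_eq_intros)
  qed
  then show ?thesis by simp
qed

text \<open>The Taylor bounds for \<open>cos\<close> and \<open>sin\<close> give the same polynomial on both sides. With the constant 3
  the row sums in Hilbert's inequality are bounded by exactly \<open>1 / \<delta>\<^sup>2\<close>.\<close>

lemma sin_square_ge:
  fixes y :: real
  assumes "0 \<le> y" "y \<le> 2"
  shows "(1 + 2 * cos y) * y\<^sup>2 \<le> 3 * (sin y)\<^sup>2"
proof -
  have "(1 + 2 * cos y) * y\<^sup>2 \<le> (1 + 2 * (1 - y\<^sup>2 / 2 + y ^ 4 / 24)) * y\<^sup>2"
    using cos_le_quartic[OF assms(1)] by (intro mult_right_mono) auto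
  also have "\<dots> = 3 * (y - y ^ 3 / 6)\<^sup>2"
    by (simp add: power2_eq_square power3_eq_cube power4_eq_xxxx algebra_simps)
  also have "\<dots> \<le> 3 * (sin y)\<^sup>2"
  proof -
    \<comment> \<open>From \<open>y \<le> 2\<close> follows \<open>y^2 \<le> 6\<close>, so the lower
      bound for the sine is nonnegative and may be squared.\<close>
    have "y * y ^ 2 \<le> y * 2\<^sup>2" using assms by (intro mult_left_mono power_mono) auto
    then have "0 \<le> y - y ^ 3 / 6" using assms by (simp add: power3_eq_cube power2_eq_square)
    then show ?thesis using sin_ge_cubic[OF assms(1)] by (simp add: power_mono)
  qed
  finally show ?thesis .
qed

text \<open>Subtracting the integer \<open>n\<close> changes sine and cosine at most by a sign,
  which the square and the absolute value absorb. Then \<open>y \<le> pi / 2 < 2\<close> lies in the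
  range of \<open>sin_square_ge\<close>.\<close>

lemma csc_cot_bound:
  fixes \<theta> :: real and n :: int
  assumes "\<bar>\<theta> - n\<bar> \<le> 1 / 2" "\<theta> \<noteq> n"
  shows "(1 / sin (pi * \<theta>))\<^sup>2 + 2 * \<bar>1 / sin (pi * \<theta>) * (cos (pi * \<theta>) / sin (pi * \<theta>))\<bar>
    \<le> 3 / pi\<^sup>2 * (1 / (\<theta> - n)\<^sup>2)"
proof -
  define y where "y = pi * \<bar>\<theta> - n\<bar>"
  have y: "0 < y" "y \<le> pi / 2"
    using assms mult_left_mono[OF assms(1), of pi] by (auto simp: y_def)
  have sin_pos: "0 < sin y" using y pi_gt_zero by (intro sin_gt_zero) linarith+
  have cos_nn: "0 \<le> cos y" using y by (intro cos_ge_zero) linarith+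
  have shift: "pi * \<theta> = pi * (\<theta> - n) + of_int n * pi" by (simp add: algebra_simps)
  have "\<bar>sin (pi * \<theta>)\<bar> = \<bar>sin (pi * (\<theta> - n))\<bar>" "\<bar>cos (pi * \<theta>)\<bar> = \<bar>cos (pi * (\<theta> - n))\<bar>"
    unfolding shift by (simp_all add: sin_add cos_add sin_npi_int cos_npi_int abs_mult mult.commute[of _ pi])
  moreover have "\<bar>sin (pi * (\<theta> - n))\<bar> = sin y" "\<bar>cos (pi * (\<theta> - n))\<bar> = cos y"
    using sin_pos cos_nn by (auto simp: y_def abs_if algebra_simps cos_diff sin_diff split: if_splits)
  ultimately have sc: "\<bar>sin (pi * \<theta>)\<bar> = sin y" "\<bar>cos (pi * \<theta>)\<bar> = cos y" by simp_all
  have "(1 / sin (pi * \<theta>))\<^sup>2 + 2 * \<bar>1 / sin (pi * \<theta>) * (cos (pi * \<theta>) / sin (pi * \<theta>))\<bar>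
    = (1 + 2 * cos y) / (sin y)\<^sup>2"
  proof -
    have "(sin (pi * \<theta>))\<^sup>2 = (sin y)\<^sup>2" using sc(1) by (metis power2_abs)
    then show ?thesis by (simp add: abs_mult sc power_divide add_divide_distrib power2_eq_square[of "sin y"])
  qed
  also have "\<dots> \<le> 3 / y\<^sup>2"
    using sin_square_ge[of y] y sin_pos pi_less_4 by (simp add: field_simps)
  also have "\<dots> = 3 / pi\<^sup>2 * (1 / (\<theta> - n)\<^sup>2)"
    by (simp add: y_def power_mult_distrib)
  finally show ?thesis .
qed

text \<open>Two points with the same integer part of \<open>a / \<delta>\<close> would be closer
  than \<delta>, so these integer parts are distinct positive integers and the sum is dominated by
  \<open>zeta(2) / \<delta>^2\<close>. The shift by 1 in \<open>g\<close> matches a series indexed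
  from 0.\<close>

lemma sum_inverse_squares_separated:
  fixes S :: "real set"
  assumes fin: "finite S" and d: "0 < \<delta>" and ge: "\<And>a. a \<in> S \<Longrightarrow> \<delta> \<le> a"
    and sep: "\<And>a b. a \<in> S \<Longrightarrow> b \<in> S \<Longrightarrow> a \<noteq> b \<Longrightarrow> \<delta> \<le> \<bar>a - b\<bar>"
  shows "(\<Sum>a\<in>S. 1 / a\<^sup>2) \<le> pi\<^sup>2 / 6 / \<delta>\<^sup>2"
proof -
  define g where "g = (\<lambda>a. nat (\<lfloor>a / \<delta>\<rfloor> - 1))"
  have floor_ge: "1 \<le> \<lfloor>a / \<delta>\<rfloor>" if "a \<in> S" for a
    using ge[OF that] d by (simp add: le_floor_iff)
  have inj: "inj_on g S"
  proof (rule inj_onI, rule ccontr)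
    fix a b assume ab: "a \<in> S" "b \<in> S" "g a = g b" "a \<noteq> b"
    then have "\<lfloor>a / \<delta>\<rfloor> = \<lfloor>b / \<delta>\<rfloor>" using floor_ge[of a] floor_ge[of b]
      by (metis diff_add_cancel g_def int_nat_eq diff_ge_0_iff_ge)
    then have "\<bar>a / \<delta> - b / \<delta>\<bar> < 1" by linarith
    then have "\<bar>a - b\<bar> < \<delta>" using d by (simp add: diff_divide_distrib[symmetric])
    with sep[of a b] ab show False by simp
  qed
  have "(\<Sum>a\<in>S. 1 / a\<^sup>2) \<le> (\<Sum>a\<in>S. 1 / (real (g a) + 1)\<^sup>2 / \<delta>\<^sup>2)"
  proof (rule sum_mono)
    fix a assume a: "a \<in> S"
    have "(real (g a) + 1) \<le> a / \<delta>" using floor_ge[OF a] by (simp add: g_def)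
    then have "(real (g a) + 1) * \<delta> \<le> a" using d by (simp add: field_simps)
    then have "((real (g a) + 1) * \<delta>)\<^sup>2 \<le> a\<^sup>2" using d by (intro power_mono) auto
    then show "1 / a\<^sup>2 \<le> 1 / (real (g a) + 1)\<^sup>2 / \<delta>\<^sup>2"
      using d by (simp add: power_mult_distrib frac_le)
  qed
  also have "\<dots> = (\<Sum>k\<in>g ` S. 1 / (real k + 1)\<^sup>2) / \<delta>\<^sup>2"
    by (simp add: sum.reindex[OF inj] sum_divide_distrib)
  also have "\<dots> \<le> pi\<^sup>2 / 6 / \<delta>\<^sup>2"
  proof (rule divide_right_mono)
    have "(\<Sum>k\<in>g ` S. 1 / (real k + 1)\<^sup>2) \<le> (\<Sum>k. 1 / (real k + 1)\<^sup>2)"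
      using inverse_squares_sums fin by (intro sum_le_suminf) (auto simp: sums_iff add.commute)
    then show "(\<Sum>k\<in>g ` S. 1 / (real k + 1)\<^sup>2) \<le> pi\<^sup>2 / 6"
      using inverse_squares_sums by (simp add: sums_iff add.commute)
  qed simp
  finally show ?thesis .
qed

text \<open>The differences reduced to \<open>[-1/2, 1/2]\<close> are again \<delta>-separated,
  since the difference of two rounding integers is an integer allowed in \<open>sep\<close>. Each
  sign contributes at most \<open>zeta(2) / \<delta>^2\<close>; the total constant
  \<open>pi^2 / 3\<close> is the reciprocal of the \<open>3 / pi^2\<close> in
  \<open>csc_cot_bound\<close>.\<close>

lemma sum_inverse_squares_separated_mod1:
  fixes W :: "real set"
  assumes fin: "finite W" and d: "0 < \<delta>"
    and sep: "\<And>a b n. a \<in> W \<Longrightarrow> b \<in> W \<Longrightarrow> a \<noteq> b \<Longrightarrow> \<delta> \<le> \<bar>a - b - of_int n\<bar>"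
    and a: "a \<in> W"
  shows "(\<Sum>b\<in>W - {a}. 1 / (a - b - of_int (round (a - b)))\<^sup>2) \<le> pi\<^sup>2 / 3 / \<delta>\<^sup>2"
proof -
  define f where "f = (\<lambda>b. a - b - of_int (round (a - b)))"
  have f_ge: "\<delta> \<le> \<bar>f b\<bar>" if "b \<in> W - {a}" for b
    using sep[OF a, of b] that by (auto simp: f_def)
  have f_sep: "\<delta> \<le> \<bar>f b - f c\<bar>" if "b \<in> W" "c \<in> W" "b \<noteq> c" for b c
    using sep[of c b "round (a - b) - round (a - c)"] that by (simp add: f_def algebra_simps)
  \<comment> \<open>The sign \<sigma> treats the positive and the negative side by one
    argument.\<close>
  have half: "(\<Sum>b\<in>V. 1 / (f b)\<^sup>2) \<le> pi\<^sup>2 / 6 / \<delta>\<^sup>2"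
    if V: "V \<subseteq> W - {a}" and sg: "\<sigma> = 1 \<or> \<sigma> = -1" and pos: "\<And>b. b \<in> V \<Longrightarrow> 0 < \<sigma> * f b" for V \<sigma>
  proof -
    have sq: "(\<sigma> * r)\<^sup>2 = r\<^sup>2" "\<bar>\<sigma> * r\<bar> = \<bar>r\<bar>" for r using sg by auto
    have inj: "inj_on (\<lambda>b. \<sigma> * f b) V"
    proof (rule inj_onI, rule ccontr)
      fix b c assume bc: "b \<in> V" "c \<in> V" "\<sigma> * f b = \<sigma> * f c" "b \<noteq> c"
      then have "\<delta> \<le> \<bar>f b - f c\<bar>" using V by (intro f_sep) auto
      moreover have "f b = f c" using bc sg by auto
      ultimately show False using d by simp
    qed
    have "(\<Sum>b\<in>V. 1 / (f b)\<^sup>2) = (\<Sum>x\<in>(\<lambda>b. \<sigma> * f b) ` V. 1 / x\<^sup>2)"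
      by (simp add: sum.reindex[OF inj] sq)
    also have "\<dots> \<le> pi\<^sup>2 / 6 / \<delta>\<^sup>2"
    proof (rule sum_inverse_squares_separated[OF _ d])
      show "finite ((\<lambda>b. \<sigma> * f b) ` V)" using fin V by (meson finite_Diff finite_imageI finite_subset)
      fix x assume "x \<in> (\<lambda>b. \<sigma> * f b) ` V"
      then obtain b where b: "b \<in> V" "x = \<sigma> * f b" by blast
      then show "\<delta> \<le> x" using f_ge[of b] V pos[of b] sq(2)[of "f b"] by auto
      fix y assume "y \<in> (\<lambda>b. \<sigma> * f b) ` V" and ne: "x \<noteq> y"
      then obtain c where c: "c \<in> V" "y = \<sigma> * f c" by blast
      have "\<delta> \<le> \<bar>f b - f c\<bar>" using b c ne V by (intro f_sep) auto
      also have "\<dots> = \<bar>x - y\<bar>"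
        unfolding b c by (simp only: right_diff_distrib[symmetric] sq)
      finally show "\<delta> \<le> \<bar>x - y\<bar>" .
    qed
    finally show ?thesis .
  qed
  have "(\<Sum>b\<in>W - {a}. 1 / (f b)\<^sup>2)
      = (\<Sum>b\<in>{b\<in>W - {a}. 0 < f b}. 1 / (f b)\<^sup>2) + (\<Sum>b\<in>{b\<in>W - {a}. f b < 0}. 1 / (f b)\<^sup>2)"
  proof -
    have split: "{b\<in>W - {a}. 0 < f b} \<union> {b\<in>W - {a}. f b < 0} = W - {a}"
      using f_ge d by force
    have "(\<Sum>b\<in>{b\<in>W - {a}. 0 < f b} \<union> {b\<in>W - {a}. f b < 0}. 1 / (f b)\<^sup>2)
      = (\<Sum>b\<in>{b\<in>W - {a}. 0 < f b}. 1 / (f b)\<^sup>2) + (\<Sum>b\<in>{b\<in>W - {a}. f b < 0}. 1 / (f b)\<^sup>2)"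
      using fin by (intro sum.union_disjoint) auto
    then show ?thesis unfolding split .
  qed
  also have "\<dots> \<le> pi\<^sup>2 / 6 / \<delta>\<^sup>2 + pi\<^sup>2 / 6 / \<delta>\<^sup>2"
    by (intro add_mono half[of _ 1] half[of _ "-1"]) auto
  finally show ?thesis by (simp add: f_def)
qed

section \<open>Hilbert's inequality for points separated modulo 1\<close>

lemma sin_pi_nonzero:
  fixes \<theta> :: real
  assumes "0 < \<delta>" and "\<And>n :: int. \<delta> \<le> \<bar>\<theta> - of_int n\<bar>"
  shows "sin (pi * \<theta>) \<noteq> 0"
proof
  assume "sin (pi * \<theta>) = 0"
  then obtain i :: int where "pi * \<theta> = of_int i * pi"
    using sin_zero_iff_int2 by blast
  then have "\<theta> - of_int i = 0" by simp
  with assms show False by (metis abs_zero not_le)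
qed

theorem hilbert_inequality:
  fixes W :: "real set" and u :: "real \<Rightarrow> real"
  assumes fin: "finite W" and d: "0 < \<delta>"
    and sep: "\<And>a b n. a \<in> W \<Longrightarrow> b \<in> W \<Longrightarrow> a \<noteq> b \<Longrightarrow> \<delta> \<le> \<bar>a - b - of_int n\<bar>"
  shows "(\<Sum>t\<in>W. (\<Sum>r\<in>W. csc t r * u r)\<^sup>2) \<le> (1 / \<delta>)\<^sup>2 * (\<Sum>t\<in>W. (u t)\<^sup>2)"
proof (rule hilbert_inequality_weighted[OF fin])
  fix a b assume ab: "a \<in> W" "b \<in> W" "a \<noteq> b"
  show "sin (pi * (a - b)) \<noteq> 0" using d sep[OF ab] by (rule sin_pi_nonzero)
next
  fix a assume a: "a \<in> W"
  have "(\<Sum>b\<in>W. (csc a b)\<^sup>2 + 2 * \<bar>csc a b * cotd a b\<bar>)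
      = (\<Sum>b\<in>W - {a}. (csc a b)\<^sup>2 + 2 * \<bar>csc a b * cotd a b\<bar>)"
    using sum.remove[OF fin a, of "\<lambda>b. (csc a b)\<^sup>2 + 2 * \<bar>csc a b * cotd a b\<bar>"] by simp
  also have "\<dots> \<le> (\<Sum>b\<in>W - {a}. 3 / pi\<^sup>2 * (1 / (a - b - of_int (round (a - b)))\<^sup>2))"
  proof (rule sum_mono)
    fix b assume b: "b \<in> W - {a}"
    have "a - b \<noteq> of_int (round (a - b))"
      using sep[OF a, of b "round (a - b)"] b d by auto
    moreover have "\<bar>a - b - of_int (round (a - b))\<bar> \<le> 1 / 2"
      using of_int_round_abs_le[of "a - b"] by (simp add: abs_minus_commute)
    ultimately show "(csc a b)\<^sup>2 + 2 * \<bar>csc a b * cotd a b\<bar>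
        \<le> 3 / pi\<^sup>2 * (1 / (a - b - of_int (round (a - b)))\<^sup>2)"
      unfolding csc_def cotd_def by (intro csc_cot_bound)
  qed
  also have "\<dots> = 3 / pi\<^sup>2 * (\<Sum>b\<in>W - {a}. 1 / (a - b - of_int (round (a - b)))\<^sup>2)"
    by (rule sum_distrib_left[symmetric])
  also have "\<dots> \<le> 3 / pi\<^sup>2 * (pi\<^sup>2 / 3 / \<delta>\<^sup>2)"
    by (intro mult_left_mono sum_inverse_squares_separated_mod1[OF fin d sep a]) auto
  also have "\<dots> = (1 / \<delta>)\<^sup>2" by (simp add: power_divide)
  finally show "(\<Sum>b\<in>W. (csc a b)\<^sup>2 + 2 * \<bar>csc a b * cotd a b\<bar>) \<le> (1 / \<delta>)\<^sup>2" .
qed simp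

section \<open>The large sieve lower bound\<close>

text \<open>The kernel is real, so the operator acts on real and imaginary parts separately;
  Cauchy-Schwarz then passes from the operator to the sesquilinear form.\<close>

lemma hilbert_inequality_complex:
  fixes W :: "real set" and v :: "real \<Rightarrow> complex"
  assumes fin: "finite W" and d: "0 < \<delta>"
    and sep: "\<And>a b n. a \<in> W \<Longrightarrow> b \<in> W \<Longrightarrow> a \<noteq> b \<Longrightarrow> \<delta> \<le> \<bar>a - b - of_int n\<bar>"
  shows "cmod (\<Sum>r\<in>W. \<Sum>t\<in>W. csc r t * v r * cnj (v t)) \<le> 1 / \<delta> * (\<Sum>r\<in>W. (cmod (v r))\<^sup>2)"
proof -
  define V where "V = (\<lambda>r. \<Sum>t\<in>W. csc r t * v t)"
  define S where "S = (\<Sum>r\<in>W. (cmod (v r))\<^sup>2)"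
  have "(\<Sum>r\<in>W. (cmod (V r))\<^sup>2) = (\<Sum>t\<in>W. (\<Sum>r\<in>W. csc t r * Re (v r))\<^sup>2) + (\<Sum>t\<in>W. (\<Sum>r\<in>W. csc t r * Im (v r))\<^sup>2)"
    by (simp add: V_def cmod_power2 sum.distrib)
  also have "\<dots> \<le> (1 / \<delta>)\<^sup>2 * (\<Sum>t\<in>W. (Re (v t))\<^sup>2) + (1 / \<delta>)\<^sup>2 * (\<Sum>t\<in>W. (Im (v t))\<^sup>2)"
    by (intro add_mono hilbert_inequality fin d sep)
  also have "\<dots> = (1 / \<delta>)\<^sup>2 * S"
    by (simp add: S_def cmod_power2 sum.distrib distrib_left)
  finally have V_le: "(\<Sum>r\<in>W. (cmod (V r))\<^sup>2) \<le> (1 / \<delta>)\<^sup>2 * S" .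
  have S0: "0 \<le> S" by (simp add: S_def sum_nonneg)
  have "(\<Sum>r\<in>W. \<Sum>t\<in>W. csc r t * v r * cnj (v t)) = (\<Sum>r\<in>W. v r * cnj (V r))"
    by (simp add: V_def sum_distrib_left mult_ac)
  also have "cmod \<dots> \<le> (\<Sum>r\<in>W. cmod (v r) * cmod (V r))"
    by (rule order_trans[OF norm_sum]) (simp add: norm_mult)
  finally have le: "cmod (\<Sum>r\<in>W. \<Sum>t\<in>W. csc r t * v r * cnj (v t)) \<le> (\<Sum>r\<in>W. cmod (v r) * cmod (V r))" .
  have "(\<Sum>r\<in>W. cmod (v r) * cmod (V r))\<^sup>2 \<le> S * (\<Sum>r\<in>W. (cmod (V r))\<^sup>2)"
    unfolding S_def by (rule Cauchy_Schwarz_ineq_sum)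
  also have "\<dots> \<le> S * ((1 / \<delta>)\<^sup>2 * S)" by (intro mult_left_mono V_le S0)
  also have "\<dots> = (1 / \<delta> * S)\<^sup>2" by (simp add: power2_eq_square)
  finally have "(\<Sum>r\<in>W. cmod (v r) * cmod (V r)) \<le> 1 / \<delta> * S"
    by (rule power2_le_imp_le) (use S0 d in simp)
  with le show ?thesis by (simp add: S_def)
qed

text \<open>The geometric sum is written as a difference of two unimodular terms over a sine, so
  that each term becomes a cosecant form in a modulated vector.\<close>

lemma sum_powers_cis:
  fixes \<theta> :: real and n :: nat
  assumes "sin (pi * \<theta>) \<noteq> 0"
  shows "(\<Sum>j<n. cis (- 2 * pi * \<theta>) ^ j)
    = \<i> / 2 * (1 / sin (pi * \<theta>)) * (cis (- (2 * real n - 1) * pi * \<theta>) - cis (pi * \<theta>))"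
proof -
  define w where "w = cis (- 2 * pi * \<theta>)"
  have s: "2 * \<i> * sin (pi * \<theta>) = cis (pi * \<theta>) - cis (- (pi * \<theta>))"
    by (simp add: complex_eq_iff)
  have w1: "1 - w = 2 * \<i> * sin (pi * \<theta>) * cis (- (pi * \<theta>))"
    unfolding s by (simp add: w_def left_diff_distrib cis_mult mult.assoc)
  then have nz: "1 - w \<noteq> 0" using assms by simp
  have "(1 - w) * (\<i> / 2 * (1 / sin (pi * \<theta>)) * (cis (- (2 * real n - 1) * pi * \<theta>) - cis (pi * \<theta>)))
     = - (cis (- (pi * \<theta>)) * (cis (- (2 * real n - 1) * pi * \<theta>) - cis (pi * \<theta>)))"
    unfolding w1 using assms by (simp add: field_simps)
  also have "\<dots> = 1 - w ^ n"
  proof -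
    have "w ^ n = cis (- (pi * \<theta>)) * cis (- (2 * real n - 1) * pi * \<theta>)"
      unfolding w_def Complex.DeMoivre cis_mult by (rule arg_cong[of _ _ cis]) (simp add: algebra_simps)
    moreover have "cis (- (pi * \<theta>)) * cis (pi * \<theta>) = 1" by (simp add: cis_mult)
    ultimately show ?thesis by (simp add: right_diff_distrib)
  qed
  also have "\<dots> = (1 - w) * (\<Sum>j<n. w ^ j)" by (rule one_diff_power_eq)
  finally show ?thesis unfolding w_def[symmetric] mult_left_cancel[OF nz] by (rule sym)
qed

text \<open>Expanding the square gives \<open>n * S\<close> from the diagonal and half the
  difference of two cosecant forms, in the vectors \<open>u r * cis (c * r)\<close> and
  \<open>u r * cis (pi * r)\<close>. Modulation preserves \<open>S\<close>, so each half costs at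
  most \<open>S / (2 * \<delta>)\<close>.\<close>

theorem large_sieve_lower:
  fixes W :: "real set" and u :: "real \<Rightarrow> complex"
  assumes fin: "finite W" and d: "0 < \<delta>"
    and sep: "\<And>a b n. a \<in> W \<Longrightarrow> b \<in> W \<Longrightarrow> a \<noteq> b \<Longrightarrow> \<delta> \<le> \<bar>a - b - of_int n\<bar>"
  shows "(real n - 1 / \<delta>) * (\<Sum>r\<in>W. (cmod (u r))\<^sup>2)
    \<le> (\<Sum>j<n. (cmod (\<Sum>r\<in>W. u r * cis (- 2 * pi * r) ^ j))\<^sup>2)"
proof -
  define S where "S = (\<Sum>r\<in>W. (cmod (u r))\<^sup>2)"
  define v where "v = (\<lambda>c r. u r * cis (c * r))"
  define B where "B = (\<lambda>c. \<Sum>r\<in>W. \<Sum>t\<in>W. csc r t * v c r * cnj (v c t))"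
  define c where "c = - (2 * real n - 1) * pi"
  have sin_nz: "sin (pi * (a - b)) \<noteq> 0" if "a \<in> W" "b \<in> W" "a \<noteq> b" for a b
    using d sep[OF that] by (rule sin_pi_nonzero)
  have B_le: "cmod (B c) \<le> 1 / \<delta> * S" for c
    using hilbert_inequality_complex[OF fin d sep, of "v c"] by (simp add: B_def S_def v_def norm_mult)
  have kernel: "(\<Sum>j<n. (cis (- 2 * pi * r) * cnj (cis (- 2 * pi * t))) ^ j)
      = (if r = t then of_nat n else 0)
        + \<i> / 2 * (csc r t * (cis (c * r) * cnj (cis (c * t)) - cis (pi * r) * cnj (cis (pi * t))))"
    if rt: "r \<in> W" "t \<in> W" for r t
  proof (cases "r = t")
    case True
    then show ?thesis by (simp add: cis_cnj cis_mult)
  next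
    case False
    have "cis (- 2 * pi * r) * cnj (cis (- 2 * pi * t)) = cis (- 2 * pi * (r - t))"
      "cis (c * r) * cnj (cis (c * t)) = cis (c * (r - t))"
      "cis (pi * r) * cnj (cis (pi * t)) = cis (pi * (r - t))"
      by (simp_all add: cis_cnj cis_mult algebra_simps)
    then show ?thesis
      using False sum_powers_cis[OF sin_nz[OF rt False], of n] by (simp add: csc_def c_def mult_ac)
  qed
  have "complex_of_real (\<Sum>j<n. (cmod (\<Sum>r\<in>W. u r * cis (- 2 * pi * r) ^ j))\<^sup>2)
      = (\<Sum>j<n. \<Sum>r\<in>W. \<Sum>t\<in>W. u r * cnj (u t) * (cis (- 2 * pi * r) * cnj (cis (- 2 * pi * t))) ^ j)"
    unfolding of_real_sum complex_norm_square
    by (simp add: sum_product power_mult_distrib mult_ac del: cis_cnj)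
  also have "\<dots> = (\<Sum>r\<in>W. \<Sum>j<n. \<Sum>t\<in>W. u r * cnj (u t) * (cis (- 2 * pi * r) * cnj (cis (- 2 * pi * t))) ^ j)"
    by (rule sum.swap)
  also have "\<dots> = (\<Sum>r\<in>W. \<Sum>t\<in>W. \<Sum>j<n. u r * cnj (u t) * (cis (- 2 * pi * r) * cnj (cis (- 2 * pi * t))) ^ j)"
    by (intro sum.cong refl sum.swap)
  also have "\<dots> = (\<Sum>r\<in>W. \<Sum>t\<in>W. u r * cnj (u t) * ((if r = t then of_nat n else 0)
        + \<i> / 2 * (csc r t * (cis (c * r) * cnj (cis (c * t)) - cis (pi * r) * cnj (cis (pi * t))))))"
    by (intro sum.cong refl) (simp only: sum_distrib_left[symmetric] kernel)
  also have "\<dots> = (\<Sum>r\<in>W. \<Sum>t\<in>W. (if r = t then of_nat n * (u r * cnj (u r)) else 0)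
      + \<i> / 2 * (csc r t * v c r * cnj (v c t)) - \<i> / 2 * (csc r t * v pi r * cnj (v pi t)))"
    unfolding v_def by (intro sum.cong refl) (simp add: algebra_simps del: cis_cnj)
  also have "\<dots> = of_nat n * (\<Sum>r\<in>W. u r * cnj (u r)) + \<i> / 2 * B c - \<i> / 2 * B pi"
    using fin unfolding B_def sum_distrib_left by (simp add: sum.distrib sum_subtractf)
  also have "(\<Sum>r\<in>W. u r * cnj (u r)) = complex_of_real S"
    by (simp only: S_def of_real_sum complex_norm_square)
  finally have eq: "complex_of_real (\<Sum>j<n. (cmod (\<Sum>r\<in>W. u r * cis (- 2 * pi * r) ^ j))\<^sup>2)
      = of_nat n * complex_of_real S + \<i> / 2 * B c - \<i> / 2 * B pi" .
  have "(\<Sum>j<n. (cmod (\<Sum>r\<in>W. u r * cis (- 2 * pi * r) ^ j))\<^sup>2) = real n * S + Re (\<i> / 2 * B c) - Re (\<i> / 2 * B pi)"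
    using arg_cong[OF eq, of Re] by simp
  moreover have "\<bar>Re (\<i> / 2 * B x)\<bar> \<le> 1 / \<delta> * S / 2" for x
  proof -
    have "\<bar>Re (\<i> / 2 * B x)\<bar> \<le> cmod (\<i> / 2 * B x)" by (rule abs_Re_le_cmod)
    also have "\<dots> = cmod (B x) / 2" by (simp add: norm_mult norm_divide)
    also have "\<dots> \<le> 1 / \<delta> * S / 2" using B_le by (rule divide_right_mono) simp
    finally show ?thesis .
  qed
  then have "Re (\<i> / 2 * B c) \<ge> - (1 / \<delta> * S / 2)" "Re (\<i> / 2 * B pi) \<le> 1 / \<delta> * S / 2"
    by (meson abs_le_D1 abs_le_D2 neg_le_iff_le minus_le_iff)+
  ultimately show ?thesis by (simp add: S_def[symmetric] left_diff_distrib)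
qed

section \<open>Interpolating polynomials\<close>

text \<open>A square system with trivial kernel is solvable; the bijection \<open>h\<close> only
  transports the index set \<open>Z\<close> to \<open>{0..<N}\<close>.\<close>

lemma linear_system_solvable:
  fixes g :: "'a \<Rightarrow> 'a \<Rightarrow> complex"
  assumes fin: "finite Z"
    and inj: "\<And>u. (\<And>s. s \<in> Z \<Longrightarrow> (\<Sum>r\<in>Z. g s r * u r) = 0) \<Longrightarrow> \<forall>r\<in>Z. u r = 0"
  obtains u where "\<And>s. s \<in> Z \<Longrightarrow> (\<Sum>r\<in>Z. g s r * u r) = b s"
proof -
  define N where "N = card Z"
  obtain h where h: "bij_betw h {0..<N} Z"
    using ex_bij_betw_nat_finite[OF fin] by (auto simp: N_def)
  define h' where "h' = the_inv_into {0..<N} h"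
  have h': "h' (h i) = i" if "i < N" for i
    using h that by (simp add: h'_def bij_betw_def the_inv_into_f_f)
  have hZ: "h i \<in> Z" if "i < N" for i using h that by (auto simp: bij_betw_def)
  have hex: "\<exists>i<N. s = h i" if "s \<in> Z" for s using h that by (auto simp: bij_betw_def)
  have reindex: "(\<Sum>i\<in>{0..<N}. f (h i)) = (\<Sum>r\<in>Z. f r)" for f :: "'a \<Rightarrow> complex"
    using sum.reindex_bij_betw[OF h] .
  define A where "A = Matrix.mat N N (\<lambda>(i, j). g (h i) (h j))"
  have A: "A \<in> carrier_mat N N" by (simp add: A_def)
  have A_mult: "(A *\<^sub>v v) $ i = (\<Sum>r\<in>Z. g (h i) r * v $ h' r)" if "v \<in> carrier_vec N" "i < N" for v i
  proof -
    have "(A *\<^sub>v v) $ i = (\<Sum>j\<in>{0..<N}. g (h i) (h j) * v $ h' (h j))"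
      using that by (simp add: A_def scalar_prod_def h')
    then show ?thesis by (simp add: reindex[of "\<lambda>r. g (h i) r * v $ h' r"])
  qed
  have "det A \<noteq> 0"
  proof
    assume "det A = 0"
    then obtain v where v: "v \<in> carrier_vec N" "v \<noteq> 0\<^sub>v N" "A *\<^sub>v v = 0\<^sub>v N"
      using det_0_iff_vec_prod_zero[OF A] by blast
    have zero: "\<forall>r\<in>Z. v $ h' r = 0"
    proof (rule inj)
      fix s assume "s \<in> Z"
      then obtain i where "i < N" "s = h i" using hex by blast
      then show "(\<Sum>r\<in>Z. g s r * v $ h' r) = 0" using A_mult[OF v(1), of i] v(3) by simp
    qed
    have "v = 0\<^sub>v N"
    proof (rule eq_vecI)
      fix i assume i: "i < dim_vec (0\<^sub>v N :: complex vec)"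
      then show "v $ i = 0\<^sub>v N $ i" using zero hZ[of i] h'[of i] by fastforce
    qed (use v in simp)
    with v(2) show False ..
  qed
  then have "A \<in> Units (ring_mat TYPE(complex) N ())" by (rule det_non_zero_imp_unit[OF A])
  then obtain B where B: "B \<in> carrier_mat N N" "A * B = 1\<^sub>m N"
    unfolding Units_def ring_mat_def by auto
  define v where "v = B *\<^sub>v Matrix.vec N (\<lambda>i. b (h i))"
  have v: "v \<in> carrier_vec N" using B by (simp add: v_def)
  have Av: "A *\<^sub>v v = Matrix.vec N (\<lambda>i. b (h i))"
    using assoc_mult_mat_vec[OF A B(1), of "Matrix.vec N (\<lambda>i. b (h i))"] B(2) by (simp add: v_def)
  show thesis
  proof
    fix s assume "s \<in> Z"
    then obtain i where "i < N" "s = h i" using hex by blast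
    then show "(\<Sum>r\<in>Z. g s r * v $ h' r) = b s" using A_mult[OF v, of i] Av by simp
  qed
qed

text \<open>The frame bound makes the Gram matrix of the nodes injective, so it can be solved for
  the unit vector at \<open>w\<close>. Pairing the system with its solution \<open>u\<close> gives
  \<open>E = cmod (u w)\<close> for the energy \<open>E\<close>, and the frame bound for the same
  \<open>u\<close> gives \<open>L * E^2 \<le> E\<close>.\<close>

lemma min_norm_interpolant:
  fixes Z :: "complex set"
  assumes fin: "finite Z" and L: "0 < L" and w: "w \<in> Z"
    and frame: "\<And>u. L * (\<Sum>z\<in>Z. (cmod (u z))\<^sup>2) \<le> (\<Sum>j<n. (cmod (\<Sum>z\<in>Z. u z * z ^ j))\<^sup>2)"
  obtains p :: "complex poly" where "\<And>j. j \<ge> n \<Longrightarrow> coeff p j = 0"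
    and "poly p w = 1" and "\<And>z. z \<in> Z \<Longrightarrow> z \<noteq> w \<Longrightarrow> poly p z = 0"
    and "(\<Sum>j<n. (cmod (coeff p j))\<^sup>2) \<le> 1 / L"
proof -
  define a where "a = (\<lambda>u j. \<Sum>z\<in>Z. u z * z ^ j :: complex)"
  define g where "g = (\<lambda>s r. \<Sum>j<n. cnj s ^ j * r ^ j :: complex)"
  have g_a: "(\<Sum>r\<in>Z. g s r * u r) = (\<Sum>j<n. cnj s ^ j * a u j)" for s u
    unfolding g_def a_def sum_distrib_right sum_distrib_left
    by (subst sum.swap) (simp add: mult_ac)
  have energy: "complex_of_real (\<Sum>j<n. (cmod (a u j))\<^sup>2) = (\<Sum>s\<in>Z. cnj (u s) * (\<Sum>r\<in>Z. g s r * u r))" for u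
  proof -
    have "complex_of_real (\<Sum>j<n. (cmod (a u j))\<^sup>2) = (\<Sum>j<n. a u j * cnj (a u j))"
      by (simp only: of_real_sum complex_norm_square)
    also have "\<dots> = (\<Sum>j<n. \<Sum>s\<in>Z. cnj (u s) * (cnj s ^ j * a u j))"
    proof (intro sum.cong refl)
      fix j
      have "cnj (a u j) = (\<Sum>s\<in>Z. cnj (u s) * cnj s ^ j)" by (simp add: a_def)
      then show "a u j * cnj (a u j) = (\<Sum>s\<in>Z. cnj (u s) * (cnj s ^ j * a u j))"
        by (simp add: sum_distrib_left mult_ac)
    qed
    also have "\<dots> = (\<Sum>s\<in>Z. \<Sum>j<n. cnj (u s) * (cnj s ^ j * a u j))" by (rule sum.swap)
    finally show ?thesis by (simp add: g_a sum_distrib_left)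
  qed
  have "\<forall>r\<in>Z. u r = 0" if "\<And>s. s \<in> Z \<Longrightarrow> (\<Sum>r\<in>Z. g s r * u r) = 0" for u
  proof -
    have "complex_of_real (\<Sum>j<n. (cmod (a u j))\<^sup>2) = 0" unfolding energy by (simp add: that)
    then have "(\<Sum>j<n. (cmod (a u j))\<^sup>2) = 0" by (simp only: of_real_eq_0_iff)
    then have "L * (\<Sum>z\<in>Z. (cmod (u z))\<^sup>2) \<le> 0" using frame[of u] by (simp add: a_def)
    then have "(\<Sum>z\<in>Z. (cmod (u z))\<^sup>2) \<le> 0" using L by (simp add: mult_le_0_iff)
    then have "(\<Sum>z\<in>Z. (cmod (u z))\<^sup>2) = 0" by (meson antisym sum_nonneg zero_le_power2)
    then show ?thesis using fin by (simp add: sum_nonneg_eq_0_iff)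
  qed
  then obtain u where u: "\<And>s. s \<in> Z \<Longrightarrow> (\<Sum>r\<in>Z. g s r * u r) = (if s = w then 1 else 0)"
    using linear_system_solvable[OF fin, of g "\<lambda>s. if s = w then 1 else 0"] by blast
  define E where "E = (\<Sum>j<n. (cmod (a u j))\<^sup>2)"
  have "complex_of_real E = (\<Sum>s\<in>Z. if s = w then cnj (u s) else 0)"
    unfolding E_def energy by (intro sum.cong refl) (simp add: u)
  then have "complex_of_real E = cnj (u w)" using fin w by simp
  then have Ew: "E = cmod (u w)"
  proof -
    have "0 \<le> E" by (simp add: E_def sum_nonneg)
    then have "E = cmod (complex_of_real E)" by simp
    also have "\<dots> = cmod (u w)" unfolding \<open>complex_of_real E = cnj (u w)\<close> by simp
    finally show ?thesis .
  qed
  have "L * E\<^sup>2 \<le> L * (\<Sum>z\<in>Z. (cmod (u z))\<^sup>2)"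
    unfolding Ew using L fin w by (intro mult_left_mono member_le_sum) auto
  also have "\<dots> \<le> E" using frame[of u] by (simp add: E_def a_def)
  finally have "L * E\<^sup>2 \<le> E" .
  then have E_le: "E \<le> 1 / L"
    using L Ew by (cases "E = 0") (auto simp: power2_eq_square field_simps)
  \<comment> \<open>The coefficients of minimal \<open>l\<^sup>2\<close> norm lie in the range of the adjoint of the evaluation map.\<close>
  define p where "p = (\<Sum>j<n. monom (cnj (a u j)) j)"
  have coeff_p: "coeff p j = (if j < n then cnj (a u j) else 0)" for j
    by (simp add: p_def coeff_sum)
  have poly_p: "poly p z = cnj (\<Sum>r\<in>Z. g z r * u r)" for z
    unfolding g_a by (simp add: p_def poly_sum poly_monom mult.commute)
  show thesis
  proof
    show "(\<Sum>j<n. (cmod (coeff p j))\<^sup>2) \<le> 1 / L"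
      using E_le by (simp add: coeff_p E_def)
  qed (use w u in \<open>auto simp: coeff_p poly_p\<close>)
qed

section \<open>Coefficient norms and values on the unit circle\<close>

lemma poly_eq_sum_lessThan:
  fixes p :: "complex poly"
  assumes "\<And>j. j \<ge> n \<Longrightarrow> coeff p j = 0"
  shows "poly p z = (\<Sum>j<n. coeff p j * z ^ j)"
proof -
  have "poly p z = (\<Sum>j\<in>{..degree p}. coeff p j * z ^ j)" by (rule poly_altdef)
  also have "\<dots> = (\<Sum>j<n. coeff p j * z ^ j)"
    using assms coeff_eq_0[of p] by (intro sum.mono_neutral_cong) (auto simp: not_le)
  finally show ?thesis .
qed

lemma norm_poly_le_l2:
  fixes p :: "complex poly"
  assumes "\<And>j. j \<ge> n \<Longrightarrow> coeff p j = 0" and z: "cmod z = 1"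
  shows "(cmod (poly p z))\<^sup>2 \<le> n * (\<Sum>j<n. (cmod (coeff p j))\<^sup>2)"
proof -
  have poly_p: "poly p z = (\<Sum>j<n. coeff p j * z ^ j)"
    using assms(1) by (rule poly_eq_sum_lessThan)
  have "cmod (poly p z) \<le> (\<Sum>j<n. cmod (coeff p j))"
    unfolding poly_p
    by (rule order_trans[OF norm_sum]) (simp add: norm_mult norm_power z)
  then have "(cmod (poly p z))\<^sup>2 \<le> (\<Sum>j<n. 1 * cmod (coeff p j))\<^sup>2" by (intro power_mono) auto
  also have "\<dots> \<le> (\<Sum>j<n. 1\<^sup>2) * (\<Sum>j<n. (cmod (coeff p j))\<^sup>2)" by (rule Cauchy_Schwarz_ineq_sum)
  finally show ?thesis by simp
qed

text \<open>A finite replacement for the integral over the circle: for fewer than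
  \<open>N + 1\<close> coefficients, orthogonality of the powers of an \<open>N\<close>-th root of
  unity is already exact.\<close>

lemma discrete_parseval:
  fixes p :: "complex poly" and N :: nat
  assumes deg: "\<And>j. j \<ge> N \<Longrightarrow> coeff p j = 0"
  shows "(\<Sum>l<N. (cmod (poly p (cis (2 * pi * l / N))))\<^sup>2) = N * (\<Sum>j<N. (cmod (coeff p j))\<^sup>2)"
proof (cases "N = 0")
  case False
  define \<omega> where "\<omega> = cis (2 * pi / N)"
  have \<omega>: "cis (2 * pi * l / N) = \<omega> ^ l" for l :: nat by (simp add: \<omega>_def Complex.DeMoivre mult_ac)
  have orth: "(\<Sum>l<N. (\<omega> ^ l) ^ j * cnj ((\<omega> ^ l) ^ k)) = (if j = k then of_nat N else 0)"
    if jk: "j < N" "k < N" for j k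
  proof (cases "j = k")
    case True
    have "x * cnj x = 1" if "cmod x = 1" for x using that by (simp add: complex_norm_square[symmetric])
    then have "(\<omega> ^ l) ^ j * cnj ((\<omega> ^ l) ^ j) = 1" for l by (simp add: \<omega>_def norm_power del: complex_cnj_power)
    with True show ?thesis by (simp del: complex_cnj_power)
  next
    case False
    define x where "x = cis (2 * pi * (real j - real k) / N)"
    have summand: "(\<omega> ^ l) ^ j * cnj ((\<omega> ^ l) ^ k) = x ^ l" for l
      by (simp add: \<omega>_def x_def Complex.DeMoivre cis_cnj cis_mult power_mult[symmetric] algebra_simps diff_divide_distrib)
    have "x \<noteq> 1"
    proof
      assume "x = 1"
      then obtain i :: int where "2 * pi * (real j - real k) / N = 2 * pi * i"
        by (auto simp: x_def cis.ctr complex_eq_iff cos_one_2pi_int)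
      then have "2 * pi * (real j - real k) = 2 * pi * (i * real N)" using \<open>N \<noteq> 0\<close> by (simp add: field_simps)
      then have "real j - real k = i * real N" by simp
      then have "real_of_int (int j - int k) = real_of_int (i * int N)" by simp
      then have "int j - int k = i * int N" by (simp only: of_int_eq_iff)
      then have "int N dvd int j - int k" by simp
      moreover have "\<bar>int j - int k\<bar> < int N" using jk by auto
      ultimately have "int j - int k = 0" by (metis abs_of_nat dvd_imp_le_int not_le)
      with False show False by simp
    qed
    moreover have "x ^ N = 1"
    proof -
      have "x ^ N = cis (2 * pi * of_int (int j - int k))" using \<open>N \<noteq> 0\<close> by (simp add: x_def Complex.DeMoivre)
      also have "\<dots> = 1" by (rule cis_multiple_2pi) simp
      finally show ?thesis .
    qed
    then have "(1 - x) * (\<Sum>l<N. x ^ l) = 0" by (simp add: one_diff_power_eq[symmetric])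
    ultimately show ?thesis using False by (simp add: summand del: complex_cnj_power)
  qed
  have poly_p: "poly p z = (\<Sum>j<N. coeff p j * z ^ j)" for z
    using deg by (rule poly_eq_sum_lessThan)
  have "complex_of_real (\<Sum>l<N. (cmod (poly p (\<omega> ^ l)))\<^sup>2)
    = (\<Sum>l<N. \<Sum>j<N. \<Sum>k<N. coeff p j * cnj (coeff p k) * ((\<omega> ^ l) ^ j * cnj ((\<omega> ^ l) ^ k)))"
    unfolding of_real_sum complex_norm_square poly_p cnj_sum sum_product
    by (simp add: mult_ac)
  also have "\<dots> = (\<Sum>j<N. \<Sum>l<N. \<Sum>k<N. coeff p j * cnj (coeff p k) * ((\<omega> ^ l) ^ j * cnj ((\<omega> ^ l) ^ k)))"
    by (rule sum.swap)
  also have "\<dots> = (\<Sum>j<N. \<Sum>k<N. \<Sum>l<N. coeff p j * cnj (coeff p k) * ((\<omega> ^ l) ^ j * cnj ((\<omega> ^ l) ^ k)))"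
    by (intro sum.cong refl sum.swap)
  also have "\<dots> = (\<Sum>j<N. \<Sum>k<N. if j = k then of_nat N * (coeff p j * cnj (coeff p k)) else 0)"
    by (intro sum.cong refl) (simp add: sum_distrib_left[symmetric] orth del: complex_cnj_power)
  also have "\<dots> = complex_of_real (N * (\<Sum>j<N. (cmod (coeff p j))\<^sup>2))"
    unfolding of_real_mult of_real_sum complex_norm_square by (simp add: sum_distrib_left)
  finally have "complex_of_real (\<Sum>l<N. (cmod (poly p (\<omega> ^ l)))\<^sup>2) = complex_of_real (N * (\<Sum>j<N. (cmod (coeff p j))\<^sup>2))" .
  then show ?thesis unfolding \<omega> by (simp only: of_real_eq_iff)
qed simp

text \<open>Both \<open>p\<close> and \<open>q * p\<close> fit into \<open>N\<close> coefficients,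
  so both norms are averages over the same \<open>N\<close> roots of unity, and there
  \<open>q\<close> is bounded pointwise.\<close>

lemma l2_mult_le:
  fixes p q :: "complex poly" and N :: nat
  assumes p: "\<And>j. j \<ge> N \<Longrightarrow> coeff p j = 0" and pq: "\<And>j. j \<ge> N \<Longrightarrow> coeff (q * p) j = 0"
    and M: "\<And>z. cmod z = 1 \<Longrightarrow> (cmod (poly q z))\<^sup>2 \<le> M"
  shows "(\<Sum>j<N. (cmod (coeff (q * p) j))\<^sup>2) \<le> M * (\<Sum>j<N. (cmod (coeff p j))\<^sup>2)"
proof (cases "N = 0")
  case False
  have "N * (\<Sum>j<N. (cmod (coeff (q * p) j))\<^sup>2) = (\<Sum>l<N. (cmod (poly (q * p) (cis (2 * pi * l / N))))\<^sup>2)"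
    by (rule discrete_parseval[OF pq, symmetric])
  also have "\<dots> \<le> (\<Sum>l<N. M * (cmod (poly p (cis (2 * pi * l / N))))\<^sup>2)"
    by (intro sum_mono) (simp add: norm_mult power_mult_distrib mult_right_mono M)
  also have "\<dots> = M * (N * (\<Sum>j<N. (cmod (coeff p j))\<^sup>2))"
    using discrete_parseval[of N p] p by (simp add: sum_distrib_left[symmetric])
  finally show ?thesis using False by (simp add: mult_ac)
qed simp

text \<open>Points are coloured one at a time; fewer than \<nu> neighbours always leave a colour
  free.\<close>

lemma greedy_colouring:
  assumes fin: "finite U" and sym: "\<And>a b. R a b \<Longrightarrow> R b a"
    and deg: "\<And>u. u \<in> U \<Longrightarrow> card {v \<in> U. v \<noteq> u \<and> R u v} < \<nu>"
  obtains c :: "'a \<Rightarrow> nat" where "\<And>u. u \<in> U \<Longrightarrow> c u < \<nu>"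
    and "\<And>u v. u \<in> U \<Longrightarrow> v \<in> U \<Longrightarrow> u \<noteq> v \<Longrightarrow> R u v \<Longrightarrow> c u \<noteq> c v"
proof -
  have "\<exists>c. (\<forall>u\<in>V. c u < \<nu>) \<and> (\<forall>u\<in>V. \<forall>v\<in>V. u \<noteq> v \<longrightarrow> R u v \<longrightarrow> c u \<noteq> c v)" if "V \<subseteq> U" for V
    using finite_subset[OF that fin] that
  proof (induction V rule: finite_induct)
    case (insert x V)
    then obtain c where c: "\<forall>u\<in>V. c u < \<nu>" "\<forall>u\<in>V. \<forall>v\<in>V. u \<noteq> v \<longrightarrow> R u v \<longrightarrow> c u \<noteq> c v" by auto
    define Nb where "Nb = {v \<in> V. R x v}"
    have "card (c ` Nb) \<le> card Nb" using insert by (intro card_image_le) (simp add: Nb_def)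
    also have "\<dots> \<le> card {v \<in> U. v \<noteq> x \<and> R x v}"
      using insert fin by (intro card_mono) (auto simp: Nb_def)
    also have "\<dots> < \<nu>" using deg insert by auto
    finally have "card (c ` Nb) < card {..<\<nu>}" by simp
    then have "\<not> {..<\<nu>} \<subseteq> c ` Nb"
      using insert(1) card_mono[of "c ` Nb" "{..<\<nu>}"] by (auto simp: Nb_def)
    then obtain k where k: "k < \<nu>" "k \<notin> c ` Nb" by auto
    have "R v x \<Longrightarrow> R x v" for v by (rule sym)
    then show ?case
      using c k insert(2) by (intro exI[of _ "c(x := k)"]) (auto simp: Nb_def)
  qed simp
  from this[OF subset_refl] obtain c where
    c: "\<forall>u\<in>U. c u < \<nu>" "\<forall>u\<in>U. \<forall>v\<in>U. u \<noteq> v \<longrightarrow> R u v \<longrightarrow> c u \<noteq> c v" by (elim exE conjE)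
  show thesis
  proof (rule that)
    show "c u < \<nu>" if "u \<in> U" for u using c(1) that by (rule bspec)
    show "c u \<noteq> c v" if "u \<in> U" "v \<in> U" "u \<noteq> v" "R u v" for u v using c(2) that by simp
  qed
qed

section \<open>Smallest singular value and the torus\<close>

definition node :: "torus \<Rightarrow> complex" where
  "node x = torus_exp 1 x"

lemma torus_exp_eq_node_power: "torus_exp j x = node x ^ j"
  unfolding node_def by transfer (simp add: exp_of_nat_mult[symmetric] mult_ac)

text \<open>The bound is proved for any eigenvalue \<open>z\<close> of the Gram matrix
  \<open>M\<close>, so it suffices that the list of singular values has length \<open>s\<close> and
  that index \<open>s - 1\<close> picks one of them. For an eigenvector \<open>v\<close> with image
  \<open>w\<close>, the functional given by \<open>f\<close> recovers each entry of \<open>v\<close>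
  from \<open>w\<close>, and Cauchy-Schwarz bounds it. Positivity is a separate claim because with
  \<open>1 / 0 = 0\<close> the second one says nothing about a zero singular value.\<close>

lemma sing_val_lower_bound:
  fixes f :: "nat \<Rightarrow> complex poly" and x :: "nat \<Rightarrow> torus"
  assumes s: "1 \<le> s"
    and deg: "\<And>k j. k \<in> {1..s} \<Longrightarrow> m \<le> j \<Longrightarrow> coeff (f k) j = 0"
    and interp: "\<And>k l. k \<in> {1..s} \<Longrightarrow> l \<in> {1..s} \<Longrightarrow>
      poly (f k) (node (x l)) = (if k = l then 1 else 0)"
  shows "0 < sing_val s (fourier_matrix m s x)"
    and "1 / (sing_val s (fourier_matrix m s x))\<^sup>2 \<le> (\<Sum>k=1..s. \<Sum>j<m. (cmod (coeff (f k) j))\<^sup>2)"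
proof -
  define A where "A = fourier_matrix m s x"
  define M where "M = mat_adjoint A * A"
  have A: "A \<in> carrier_mat m s" by (simp add: A_def fourier_matrix_def)
  have adj: "mat_adjoint A \<in> carrier_mat s m" using A by (auto simp: mat_adjoint_def)
  have M: "M \<in> carrier_mat s s" using A adj by (simp add: M_def)
  define \<sigma> where "\<sigma> = sing_val s A"
  have nonzero: "char_poly M \<noteq> 0" using degree_monic_char_poly[OF M] by auto
  define ms where "ms = image_mset (\<lambda>z. sqrt (Re z)) (proots (char_poly M))"
  have size: "size ms = s" using degree_monic_char_poly[OF M] by (simp add: ms_def size_proots_complex)
  have "\<sigma> = rev (sorted_list_of_multiset ms) ! (s - 1)"
    by (simp add: \<sigma>_def sing_val_def sing_vals_def ms_def M_def)
  moreover have "length (rev (sorted_list_of_multiset ms)) = s"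
    by (metis length_rev mset_sorted_list_of_multiset size size_mset)
  ultimately have "\<sigma> \<in> set (rev (sorted_list_of_multiset ms))"
    using s by (metis Suc_diff_1 lessI less_eq_Suc_le nth_mem One_nat_def)
  then have "\<sigma> \<in># ms" by simp
  then obtain z where z: "\<sigma> = sqrt (Re z)" "poly (char_poly M) z = 0"
    using nonzero by (auto simp: ms_def)
  then obtain v where v: "v \<in> carrier_vec s" "v \<noteq> 0\<^sub>v s" "M *\<^sub>v v = z \<cdot>\<^sub>v v"
    using eigenvalue_root_char_poly[OF M] M unfolding eigenvalue_def eigenvector_def by auto
  \<comment> \<open>Columns are counted from 0 and points from 1: column \<open>k\<close> belongs to
    \<open>x (Suc k)\<close>, and its coordinate is recovered by \<open>f (Suc k)\<close>.\<close>
  define e where "e = (\<lambda>k. node (x (Suc k)))"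
  have A_nth: "A $$ (j, k) = e k ^ j" if "j < m" "k < s" for j k
    using that by (simp add: A_def fourier_matrix_def e_def torus_exp_eq_node_power)
  define w where "w = (\<lambda>j. \<Sum>k<s. e k ^ j * v $ k)"
  have Mv: "(M *\<^sub>v v) $ i = (\<Sum>j<m. cnj (e i) ^ j * w j)" if i: "i < s" for i
  proof -
    have "M *\<^sub>v v = mat_adjoint A *\<^sub>v (A *\<^sub>v v)"
      unfolding M_def by (rule assoc_mult_mat_vec[OF adj A v(1)])
    moreover have "(A *\<^sub>v v) $ j = w j" if "j < m" for j
      using that A v(1) by (simp add: scalar_prod_def w_def A_nth atLeast0LessThan)
    moreover have "mat_adjoint A $$ (i, j) = cnj (e i) ^ j" if "j < m" for j
      using that i A by (simp add: mat_adjoint_def mat_of_rows_def A_nth)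
    ultimately show ?thesis
      using i A adj v(1) by (simp add: scalar_prod_def atLeast0LessThan)
  qed
  define V where "V = (\<Sum>k<s. (cmod (v $ k))\<^sup>2)"
  define S where "S = (\<Sum>j<m. (cmod (w j))\<^sup>2)"
  have V_pos: "0 < V"
  proof -
    obtain k where "k < s" "v $ k \<noteq> 0" using v(1,2) by (metis carrier_vecD eq_vecI index_zero_vec)
    then show ?thesis unfolding V_def by (intro sum_pos2[of _ k]) auto
  qed
  have "z * complex_of_real V = (\<Sum>i<s. cnj (v $ i) * (M *\<^sub>v v) $ i)"
    unfolding V_def of_real_sum complex_norm_square v(3) using v(1)
    by (simp add: sum_distrib_left mult_ac)
  also have "\<dots> = (\<Sum>i<s. \<Sum>j<m. cnj (v $ i) * (cnj (e i) ^ j * w j))"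
    by (simp add: Mv sum_distrib_left)
  also have "\<dots> = (\<Sum>j<m. \<Sum>i<s. cnj (v $ i) * (cnj (e i) ^ j * w j))"
    by (rule sum.swap)
  also have "\<dots> = (\<Sum>j<m. w j * cnj (w j))"
  proof (intro sum.cong refl)
    fix j
    have "cnj (w j) = (\<Sum>i<s. cnj (e i) ^ j * cnj (v $ i))" by (simp add: w_def)
    then show "(\<Sum>i<s. cnj (v $ i) * (cnj (e i) ^ j * w j)) = w j * cnj (w j)"
      by (simp add: sum_distrib_left mult_ac)
  qed
  also have "\<dots> = complex_of_real S"
    by (simp only: S_def of_real_sum complex_norm_square)
  finally have "Re (z * complex_of_real V) = Re (complex_of_real S)" by (rule arg_cong)
  then have "Re z * V = S" by simp
  define F where "F = (\<lambda>k. \<Sum>j<m. (cmod (coeff (f k) j))\<^sup>2)"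
  have comp: "(cmod (v $ k))\<^sup>2 \<le> F (Suc k) * S" if k: "k < s" for k
  proof -
    have poly_f: "poly (f (Suc k)) y = (\<Sum>j<m. coeff (f (Suc k)) j * y ^ j)" for y
      using k by (intro poly_eq_sum_lessThan deg) auto
    have "(\<Sum>j<m. coeff (f (Suc k)) j * w j) = (\<Sum>l<s. poly (f (Suc k)) (e l) * v $ l)"
      unfolding poly_f w_def sum_distrib_left sum_distrib_right
      by (subst sum.swap) (simp add: mult_ac)
    also have "\<dots> = (\<Sum>l<s. if l = k then v $ l else 0)"
      using k interp by (intro sum.cong) (auto simp: e_def)
    finally have "v $ k = (\<Sum>j<m. coeff (f (Suc k)) j * w j)" using k by simp
    then have "cmod (v $ k) \<le> (\<Sum>j<m. cmod (coeff (f (Suc k)) j) * cmod (w j))"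
      by (simp add: norm_mult[symmetric] norm_sum)
    then have "(cmod (v $ k))\<^sup>2 \<le> (\<Sum>j<m. cmod (coeff (f (Suc k)) j) * cmod (w j))\<^sup>2"
      by (intro power_mono) auto
    also have "\<dots> \<le> F (Suc k) * S" unfolding F_def S_def by (rule Cauchy_Schwarz_ineq_sum)
    finally show ?thesis .
  qed
  have "V \<le> (\<Sum>k<s. F (Suc k)) * S"
    unfolding V_def sum_distrib_right by (intro sum_mono comp) simp
  also have "(\<Sum>k<s. F (Suc k)) = (\<Sum>k=1..s. F k)"
    by (simp add: sum.atLeast_Suc_atMost_Suc_shift[symmetric] sum.shift_bounds_Suc_ivl[symmetric] lessThan_atLeast0 atLeastLessThanSuc_atLeastAtMost)
  finally have "V * 1 \<le> V * ((\<Sum>k=1..s. F k) * Re z)"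
    unfolding \<open>Re z * V = S\<close>[symmetric] by (simp add: mult_ac)
  then have one: "1 \<le> (\<Sum>k=1..s. F k) * Re z" using V_pos by (simp only: mult_le_cancel_left_pos)
  have "0 \<le> (\<Sum>k=1..s. F k)" by (simp add: F_def sum_nonneg)
  then have pos: "0 < Re z" using one by (smt (verit) mult_nonneg_nonpos)
  then show "0 < sing_val s (fourier_matrix m s x)" using z(1) by (simp add: \<sigma>_def A_def)
  have "1 / Re z \<le> (\<Sum>k=1..s. F k)" using one pos by (simp add: field_simps)
  then show "1 / (sing_val s (fourier_matrix m s x))\<^sup>2 \<le> (\<Sum>k=1..s. \<Sum>j<m. (cmod (coeff (f k) j))\<^sup>2)"
    using z(1) pos by (simp add: \<sigma>_def A_def F_def)
qed

section \<open>Distances on the torus and chords between nodes\<close>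

lemma abs_torus_rep: "abs_torus (rep_torus x) = x"
  by (rule Quotient_abs_rep[OF Quotient_torus])

lemma torus_abs_diff_le: "torus_abs (x - y) \<le> \<bar>rep_torus x - rep_torus y - of_int n\<bar>"
  using torus_abs_attained[of "rep_torus x - rep_torus y"]
  by (simp add: minus_torus.abs_eq[symmetric] abs_torus_rep)

lemma torus_abs_diff_attained: "\<exists>n :: int. torus_abs (x - y) = \<bar>rep_torus x - rep_torus y - of_int n\<bar>"
  using torus_abs_attained[of "rep_torus x - rep_torus y"]
  by (simp add: minus_torus.abs_eq[symmetric] abs_torus_rep)

lemma torus_abs_nonneg: "0 \<le> torus_abs x"
  using torus_abs_attained[of "rep_torus x"] by (auto simp: abs_torus_rep)

lemma torus_abs_zero [simp]: "torus_abs 0 = 0"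
  using torus_abs_diff_le[of 0 0 0] torus_abs_nonneg[of 0] by simp

lemma torus_abs_minus_commute: "torus_abs (x - y) = torus_abs (y - x)"
proof -
  have "torus_abs (a - b) \<le> torus_abs (b - a)" for a b
  proof -
    obtain n :: int where "torus_abs (b - a) = \<bar>rep_torus b - rep_torus a - of_int n\<bar>"
      using torus_abs_diff_attained by blast
    then show ?thesis using torus_abs_diff_le[of a b "- n"] by simp
  qed
  then show ?thesis by (meson antisym)
qed

lemma torus_abs_diff_pos: "0 < torus_abs (x - y)" if "x \<noteq> y"
proof (rule ccontr)
  assume "\<not> 0 < torus_abs (x - y)"
  then have "torus_abs (x - y) = 0" using torus_abs_nonneg[of "x - y"] by simp
  then obtain n :: int where "rep_torus x - rep_torus y = of_int n"
    using torus_abs_diff_attained[of x y] by auto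
  then have "abs_torus (rep_torus x) = abs_torus (rep_torus y)"
    unfolding torus.abs_eq_iff by simp
  with that show False by (simp add: abs_torus_rep)
qed

lemma node_eq_cis: "node x = cis (- 2 * pi * rep_torus x)"
proof -
  have "torus_exp 1 (abs_torus t) = cis (- 2 * pi * t)" for t
    by (simp add: torus_exp.abs_eq cis_conv_exp mult_ac)
  from this[of "rep_torus x"] show ?thesis unfolding node_def abs_torus_rep .
qed

lemma norm_node [simp]: "cmod (node x) = 1"
  by (simp add: node_eq_cis)

text \<open>By concavity the sine lies above its chord between 0 and \<open>pi / 2\<close>.\<close>

lemma sin_pi_ge: "2 * v \<le> sin (pi * v)" if "0 \<le> v" "v \<le> 1 / 2" for v :: real
proof -
  have "concave_on {0..pi} sin"
    by (rule f''_le0_imp_concave[where f' = cos and f'' = "\<lambda>x. - sin x"])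
       (auto intro!: derivative_eq_intros sin_ge_zero)
  then have "(1 - 2 * v) * sin 0 + 2 * v * sin (pi / 2) \<le> sin ((1 - 2 * v) *\<^sub>R 0 + (2 * v) *\<^sub>R (pi / 2))"
    using that by (intro concave_onD) auto
  then show ?thesis by (simp add: mult.commute)
qed

text \<open>The chord between the two powers has length
  \<open>2 * \<bar>sin (pi * n * t)\<bar>\<close> with \<open>t\<close> the distance of the points.
  The hypothesis keeps the angle in the range of \<open>sin_pi_ge\<close>.\<close>

lemma norm_node_power_diff_ge:
  assumes "real n * torus_abs (y - x) \<le> 1 / 2"
  shows "4 * (real n * torus_abs (y - x)) \<le> cmod (node x ^ n - node y ^ n)"
proof -
  obtain N :: int where N: "torus_abs (y - x) = \<bar>rep_torus y - rep_torus x - of_int N\<bar>"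
    using torus_abs_diff_attained by blast
  define \<theta> where "\<theta> = rep_torus y - rep_torus x - of_int N"
  define c where "c = pi * (real n * \<theta>)"
  have "cis (- 2 * pi * of_int N) = 1"
    using cis_multiple_2pi[of "- of_int N"] by (simp add: mult_ac)
  then have y: "node y = node x * cis (- 2 * pi * \<theta>)"
  proof -
    have "node x * cis (- 2 * pi * \<theta>) = cis (- 2 * pi * rep_torus x + - 2 * pi * \<theta> + - 2 * pi * of_int N)"
      unfolding node_eq_cis cis_mult[symmetric] \<open>cis (- 2 * pi * of_int N) = 1\<close> by simp
    also have "\<dots> = node y" unfolding node_eq_cis by (rule arg_cong[of _ _ cis]) (simp add: \<theta>_def algebra_simps)
    finally show ?thesis by simp
  qed
  have "node x ^ n - node y ^ n = node x ^ n * (1 - cis (- 2 * c))"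
    by (simp add: y power_mult_distrib Complex.DeMoivre c_def right_diff_distrib mult_ac)
  also have "1 - cis (- 2 * c) = 2 * \<i> * sin c * cis (- c)"
  proof -
    have "2 * \<i> * sin c = cis c - cis (- c)" by (simp add: complex_eq_iff)
    then show ?thesis by (simp add: left_diff_distrib cis_mult)
  qed
  finally have "cmod (node x ^ n - node y ^ n) = 2 * \<bar>sin c\<bar>"
    by (simp add: norm_mult norm_power)
  moreover have "2 * (real n * \<bar>\<theta>\<bar>) \<le> sin (pi * (real n * \<bar>\<theta>\<bar>))"
    using assms N by (intro sin_pi_ge) (auto simp: \<theta>_def)
  then have "2 * (real n * \<bar>\<theta>\<bar>) \<le> \<bar>sin c\<bar>"
    by (cases "0 \<le> \<theta>") (auto simp: c_def)
  ultimately show ?thesis using N by (simp add: \<theta>_def)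
qed

lemma torus_abs_le_half: "torus_abs x \<le> 1 / 2"
proof -
  have "torus_abs x \<le> \<bar>rep_torus x - of_int (round (rep_torus x))\<bar>"
    using torus_abs_attained[of "rep_torus x"] unfolding abs_torus_rep by blast
  also have "\<dots> \<le> 1 / 2"
    using of_int_round_abs_le[of "rep_torus x"] by (simp add: abs_minus_commute)
  finally show ?thesis .
qed

lemma node_eq_iff: "node x = node y \<longleftrightarrow> x = y"
  using norm_node_power_diff_ge[of 1 y x] torus_abs_le_half[of "y - x"] torus_abs_diff_pos[of y x]
  by fastforce

section \<open>Local interpolants\<close>

lemma separated_interpolant:
  fixes W :: "torus set"
  assumes fin: "finite W" and x: "x \<in> W" and \<tau>: "0 < \<tau>"
    and sep: "\<And>y z. y \<in> W \<Longrightarrow> z \<in> W \<Longrightarrow> y \<noteq> z \<Longrightarrow> \<tau> \<le> torus_abs (y - z)"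
  obtains p :: "complex poly" where "degree p \<le> 2 / \<tau>" and "poly p (node x) = 1"
    and "\<And>y. y \<in> W \<Longrightarrow> y \<noteq> x \<Longrightarrow> poly p (node y) = 0"
    and "\<And>z. cmod z = 1 \<Longrightarrow> (cmod (poly p z))\<^sup>2 \<le> 2"
proof -
  \<comment> \<open>The frame bound \<open>n - 1 / \<tau>\<close> is at least \<open>n / 2\<close>, and \<open>\<parallel>p\<parallel>\<^sub>\<infinity>\<^sup>2 \<le> n * \<parallel>p\<parallel>\<^sub>2\<^sup>2\<close>.\<close>
  define n where "n = nat \<lceil>2 / \<tau>\<rceil>"
  define L where "L = real n - 1 / \<tau>"
  have n: "2 / \<tau> \<le> n" "real n < 2 / \<tau> + 1" using \<tau> by (simp_all add: n_def) linarith+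
  have n_pos: "0 < n" using n(1) \<tau> by (metis divide_pos_pos gr0I of_nat_0 not_le zero_less_numeral)
  have L: "real n \<le> 2 * L" "0 < L" using n(1) \<tau> by (simp_all add: L_def field_simps)
  have inj_rep: "inj_on rep_torus W" by (metis abs_torus_rep inj_onI)
  have inj_node: "inj_on node W" by (auto simp: inj_on_def node_eq_iff)
  have frame: "L * (\<Sum>z\<in>node ` W. (cmod (u z))\<^sup>2) \<le> (\<Sum>j<n. (cmod (\<Sum>z\<in>node ` W. u z * z ^ j))\<^sup>2)" for u
  proof -
    define v where "v = (\<lambda>r. u (cis (- 2 * pi * r)))"
    have reindex: "(\<Sum>z\<in>node ` W. f z) = (\<Sum>r\<in>rep_torus ` W. f (cis (- 2 * pi * r)))"
      for f :: "complex \<Rightarrow> 'z :: comm_monoid_add"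
      unfolding sum.reindex[OF inj_rep] sum.reindex[OF inj_node] by (simp add: node_eq_cis)
    have "(real n - 1 / \<tau>) * (\<Sum>r\<in>rep_torus ` W. (cmod (v r))\<^sup>2)
      \<le> (\<Sum>j<n. (cmod (\<Sum>r\<in>rep_torus ` W. v r * cis (- 2 * pi * r) ^ j))\<^sup>2)"
    proof (rule large_sieve_lower[OF _ \<tau>])
      fix a b :: real and k :: int
      assume "a \<in> rep_torus ` W" "b \<in> rep_torus ` W" "a \<noteq> b"
      then obtain y z where yz: "y \<in> W" "z \<in> W" "y \<noteq> z" "a = rep_torus y" "b = rep_torus z" by blast
      then show "\<tau> \<le> \<bar>a - b - of_int k\<bar>"
        using sep[of y z] torus_abs_diff_le[of y z k] by simp
    qed (use fin in simp)
    then show ?thesis by (simp add: reindex v_def L_def)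
  qed
  obtain p where p: "\<And>j. j \<ge> n \<Longrightarrow> coeff p j = 0" "poly p (node x) = 1"
    "\<And>z. z \<in> node ` W \<Longrightarrow> z \<noteq> node x \<Longrightarrow> poly p z = 0"
    "(\<Sum>j<n. (cmod (coeff p j))\<^sup>2) \<le> 1 / L"
    using min_norm_interpolant[OF _ L(2) _ frame, of "node x"] fin x by auto
  show thesis
  proof
    \<comment> \<open>Rounding \<open>2 / \<tau>\<close> up costs no degree, because
      \<open>n\<close> coefficients mean degree at most \<open>n - 1\<close>, which is below
      \<open>2 / \<tau>\<close>.\<close>
    have "degree p \<le> n - 1" using p(1) by (intro degree_le) auto
    then show "degree p \<le> 2 / \<tau>" using n(2) n_pos by linarith
    show "poly p (node x) = 1" by (rule p(2))
    show "poly p (node y) = 0" if "y \<in> W" "y \<noteq> x" for y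
      using that by (intro p(3)) (auto simp: node_eq_iff)
    show "(cmod (poly p z))\<^sup>2 \<le> 2" if "cmod z = 1" for z
    proof -
      have "(cmod (poly p z))\<^sup>2 \<le> n * (\<Sum>j<n. (cmod (coeff p j))\<^sup>2)"
        using p(1) that by (rule norm_poly_le_l2)
      also have "\<dots> \<le> n * (1 / L)" using p(4) by (intro mult_left_mono) auto
      also have "\<dots> \<le> 2" using L by (simp add: field_simps)
      finally show ?thesis .
    qed
  qed
qed

lemma local_sparsity_ge:
  assumes "finite U" "u \<in> U"
  shows "card {u' \<in> U. torus_abs (u - u') \<le> \<tau>} \<le> local_sparsity \<tau> U"
  using assms by (auto simp: local_sparsity_def)

lemma good_set_interpolant:
  fixes G :: "torus set"
  assumes fin: "finite G" and \<tau>: "0 < \<tau>" and far: "\<And>y. y \<in> G \<Longrightarrow> \<tau> < torus_abs (x - y)"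
  obtains p :: "complex poly" where "degree p \<le> 2 * real (local_sparsity \<tau> G) / \<tau>"
    and "poly p (node x) = 1" and "\<And>y. y \<in> G \<Longrightarrow> poly p (node y) = 0"
    and "\<And>z. cmod z = 1 \<Longrightarrow> (cmod (poly p z))\<^sup>2 \<le> 2 ^ local_sparsity \<tau> G"
proof -
  define \<nu> where "\<nu> = local_sparsity \<tau> G"
  have *: "card {v \<in> G. v \<noteq> u \<and> torus_abs (u - v) \<le> \<tau>} < \<nu>" if u: "u \<in> G" for u
  proof -
    \<comment> \<open>The local sparsity counts \<open>u\<close> itself, which makes the inequality
      strict and \<nu> colours sufficient.\<close>
    have "card {v \<in> G. v \<noteq> u \<and> torus_abs (u - v) \<le> \<tau>} < card {v \<in> G. torus_abs (u - v) \<le> \<tau>}"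
    proof (rule psubset_card_mono)
      have "u \<in> {v \<in> G. torus_abs (u - v) \<le> \<tau>}" using u \<tau> by simp
      then show "{v \<in> G. v \<noteq> u \<and> torus_abs (u - v) \<le> \<tau>} \<subset> {v \<in> G. torus_abs (u - v) \<le> \<tau>}"
        by blast
    qed (use fin in simp)
    also have "\<dots> \<le> \<nu>" unfolding \<nu>_def by (rule local_sparsity_ge[OF fin u])
    finally show ?thesis .
  qed
  obtain c :: "torus \<Rightarrow> nat" where c: "\<And>u. u \<in> G \<Longrightarrow> c u < \<nu>"
    "\<And>u v. u \<in> G \<Longrightarrow> v \<in> G \<Longrightarrow> u \<noteq> v \<Longrightarrow> torus_abs (u - v) \<le> \<tau> \<Longrightarrow> c u \<noteq> c v"
  proof -
    have "torus_abs (v - u) \<le> \<tau>" if "torus_abs (u - v) \<le> \<tau>" for u v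
      using that by (subst torus_abs_minus_commute)
    from greedy_colouring[OF fin this *] that show thesis by blast
  qed
  have "\<exists>p :: complex poly. degree p \<le> 2 / \<tau> \<and> poly p (node x) = 1 \<and>
      (\<forall>y\<in>G. c y = i \<longrightarrow> poly p (node y) = 0) \<and> (\<forall>z. cmod z = 1 \<longrightarrow> (cmod (poly p z))\<^sup>2 \<le> 2)" for i
  proof -
    \<comment> \<open>Every point of \<open>G\<close> is further than \<tau> from \<open>x\<close>,
      so \<open>x\<close> can join each colour class without spoiling the separation. Each factor is
      thus normalised at \<open>x\<close>, and so is the product.\<close>
    define W where "W = insert x {y \<in> G. c y = i}"
    have "\<tau> \<le> torus_abs (y - z)" if "y \<in> W" "z \<in> W" "y \<noteq> z" for y z
      using that far[of y] far[of z] c(2)[of y z] torus_abs_minus_commute[of y x]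
      by (cases "torus_abs (y - z) \<le> \<tau>") (auto simp: W_def intro: less_imp_le)
    then obtain p :: "complex poly" where "degree p \<le> 2 / \<tau>" "poly p (node x) = 1"
      "\<And>y. y \<in> W \<Longrightarrow> y \<noteq> x \<Longrightarrow> poly p (node y) = 0"
      "\<And>z. cmod z = 1 \<Longrightarrow> (cmod (poly p z))\<^sup>2 \<le> 2"
      using separated_interpolant[of W x \<tau>] fin \<tau> by (auto simp: W_def)
    moreover have "y \<noteq> x" if "y \<in> G" for y using far[OF that] \<tau> by auto
    ultimately show ?thesis by (auto simp: W_def)
  qed
  then obtain P :: "nat \<Rightarrow> complex poly" where P: "\<And>i. degree (P i) \<le> 2 / \<tau>" "\<And>i. poly (P i) (node x) = 1"
    "\<And>i y. y \<in> G \<Longrightarrow> c y = i \<Longrightarrow> poly (P i) (node y) = 0"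
    "\<And>i z. cmod z = 1 \<Longrightarrow> (cmod (poly (P i) z))\<^sup>2 \<le> 2"
    by metis
  show thesis
  proof
    have "real (degree (\<Prod>i<\<nu>. P i)) \<le> (\<Sum>i<\<nu>. real (degree (P i)))"
      using degree_prod_sum_le[of "{..<\<nu>}" P] by (simp add: of_nat_sum[symmetric] del: of_nat_sum)
    also have "\<dots> \<le> (\<Sum>i<\<nu>. 2 / \<tau>)" by (intro sum_mono P)
    finally show "degree (\<Prod>i<\<nu>. P i) \<le> 2 * real (local_sparsity \<tau> G) / \<tau>" by (simp add: \<nu>_def mult.commute)
    show "poly (\<Prod>i<\<nu>. P i) (node x) = 1" by (simp add: poly_prod P)
    show "poly (\<Prod>i<\<nu>. P i) (node y) = 0" if "y \<in> G" for y
      using c(1)[OF that] P(3)[OF that refl] by (auto simp: poly_prod)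
    show "(cmod (poly (\<Prod>i<\<nu>. P i) z))\<^sup>2 \<le> 2 ^ local_sparsity \<tau> G" if "cmod z = 1" for z
    proof -
      have "(cmod (poly (\<Prod>i<\<nu>. P i) z))\<^sup>2 = (\<Prod>i<\<nu>. (cmod (poly (P i) z))\<^sup>2)"
        by (simp add: poly_prod prod_norm[symmetric] prod_power_distrib)
      also have "\<dots> \<le> (\<Prod>i<\<nu>. 2)" by (intro prod_mono) (simp add: P that)
      finally show ?thesis by (simp add: \<nu>_def)
    qed
  qed
qed

section \<open>Factors for the near points and the assembled interpolant\<close>

text \<open>On the unit circle the numerator \<open>z ^ n - node y ^ n\<close> is at most 2 in
  modulus, while the denominator is at least \<open>4 * n * t\<close> by
  \<open>norm_node_power_diff_ge\<close>, with \<open>t\<close> the distance of the points. At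
  \<open>n * t = 1 / 2\<close> the resulting bound is 1.\<close>

lemma two_point_factor:
  assumes n: "0 < n" and half: "real n * torus_abs (y - x) \<le> 1 / 2" and ne: "y \<noteq> x"
  obtains p :: "complex poly" where "degree p \<le> n" and "poly p (node x) = 1" and "poly p (node y) = 0"
    and "\<And>z. cmod z = 1 \<Longrightarrow> (cmod (poly p z))\<^sup>2 \<le> (1 / (2 * real n * torus_abs (y - x)))\<^sup>2"
proof -
  define d where "d = node x ^ n - node y ^ n"
  define t where "t = torus_abs (y - x)"
  have t: "0 < t" using torus_abs_diff_pos[OF ne] by (simp add: t_def)
  have d_ge: "4 * (real n * t) \<le> cmod d"
    unfolding d_def t_def by (rule norm_node_power_diff_ge[OF half])
  moreover have nt: "0 < 4 * (real n * t)" using n t by simp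
  ultimately have d_pos: "0 < cmod d" by linarith
  then have d: "d \<noteq> 0" by auto
  define p where "p = smult (1 / d) (monom 1 n - [:node y ^ n:])"
  have poly_p: "poly p z = (z ^ n - node y ^ n) / d" for z
    by (simp add: p_def poly_monom diff_divide_distrib)
  show thesis
  proof
    have "degree (monom 1 n - [:node y ^ n:]) \<le> n"
      by (rule degree_diff_le) (simp_all add: degree_monom_le)
    then show "degree p \<le> n" by (simp add: p_def)
    show "poly p (node x) = 1" using d by (simp add: poly_p d_def)
    show "poly p (node y) = 0" by (simp add: poly_p)
    fix z :: complex assume z: "cmod z = 1"
    have "cmod (z ^ n - node y ^ n) \<le> 2"
      using norm_triangle_ineq4[of "z ^ n" "node y ^ n"] by (simp add: norm_power z)
    then have "cmod (poly p z) \<le> 2 / (4 * (real n * t))"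
      unfolding poly_p norm_divide by (intro frac_le d_ge nt) auto
    also have "\<dots> = 1 / (2 * real n * t)" by simp
    finally show "(cmod (poly p z))\<^sup>2 \<le> (1 / (2 * real n * torus_abs (y - x)))\<^sup>2"
      unfolding t_def by (intro power_mono) auto
  qed
qed

text \<open>By Cauchy-Schwarz, \<open>1 / n\<close> is the least squared \<open>l2\<close> norm for
  \<open>n\<close> coefficients and value 1 at a point of the circle; it is attained by coefficients
  of equal modulus aligned with the conjugate powers of the node.\<close>

lemma dirichlet_poly:
  assumes n: "0 < n"
  obtains p :: "complex poly" where "\<And>j. n \<le> j \<Longrightarrow> coeff p j = 0" and "poly p (node x) = 1"
    and "\<And>m. n \<le> m \<Longrightarrow> (\<Sum>j<m. (cmod (coeff p j))\<^sup>2) = 1 / real n"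
proof -
  define p where "p = (\<Sum>j<n. monom (cnj (node x) ^ j / of_nat n) j)"
  have coeff_p: "coeff p j = (if j < n then cnj (node x) ^ j / of_nat n else 0)" for j
    by (simp add: p_def coeff_sum)
  have "cnj (node x) * node x = 1"
    using complex_norm_square[of "node x"] by (simp add: mult.commute)
  then have unit: "cnj (node x) ^ j * node x ^ j = 1" for j
    by (simp add: power_mult_distrib[symmetric])
  show thesis
  proof
    show "poly p (node x) = 1" using n unit by (simp add: p_def poly_sum poly_monom)
    fix m assume "n \<le> m"
    then have "(\<Sum>j<m. (cmod (coeff p j))\<^sup>2) = (\<Sum>j<n. (cmod (coeff p j))\<^sup>2)"
      by (intro sum.mono_neutral_right) (auto simp: coeff_p)
    also have "\<dots> = (\<Sum>j<n. 1 / (real n)\<^sup>2)"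
      by (intro sum.cong) (simp_all add: coeff_p norm_divide norm_power power_divide)
    also have "\<dots> = 1 / real n" by (simp add: power2_eq_square)
    finally show "(\<Sum>j<m. (cmod (coeff p j))\<^sup>2) = 1 / real n" .
  qed (simp add: coeff_p)
qed

lemma two_point_product:
  fixes A :: "torus set" and n :: "torus \<Rightarrow> nat"
  assumes fin: "finite A" and n: "\<And>y. y \<in> A \<Longrightarrow> 0 < n y"
    and half: "\<And>y. y \<in> A \<Longrightarrow> real (n y) * torus_abs (y - x) \<le> 1 / 2" and ne: "x \<notin> A"
  obtains p :: "complex poly" where "degree p \<le> (\<Sum>y\<in>A. n y)" and "poly p (node x) = 1"
    and "\<And>y. y \<in> A \<Longrightarrow> poly p (node y) = 0"
    and "\<And>z. cmod z = 1 \<Longrightarrow> (cmod (poly p z))\<^sup>2 \<le> (\<Prod>y\<in>A. (1 / (2 * real (n y) * torus_abs (y - x)))\<^sup>2)"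
proof -
  have "\<exists>p :: complex poly. degree p \<le> n y \<and> poly p (node x) = 1 \<and> poly p (node y) = 0 \<and>
      (\<forall>z. cmod z = 1 \<longrightarrow> (cmod (poly p z))\<^sup>2 \<le> (1 / (2 * real (n y) * torus_abs (y - x)))\<^sup>2)"
    if y: "y \<in> A" for y
  proof -
    have "y \<noteq> x" using y ne by auto
    from two_point_factor[OF n[OF y] half[OF y] this] show ?thesis by metis
  qed
  then obtain P :: "torus \<Rightarrow> complex poly" where P: "\<And>y. y \<in> A \<Longrightarrow> degree (P y) \<le> n y"
    "\<And>y. y \<in> A \<Longrightarrow> poly (P y) (node x) = 1" "\<And>y. y \<in> A \<Longrightarrow> poly (P y) (node y) = 0"
    "\<And>y z. y \<in> A \<Longrightarrow> cmod z = 1 \<Longrightarrow> (cmod (poly (P y) z))\<^sup>2 \<le> (1 / (2 * real (n y) * torus_abs (y - x)))\<^sup>2"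
    by metis
  show thesis
  proof
    have "degree (\<Prod>y\<in>A. P y) \<le> (\<Sum>y\<in>A. degree (P y))"
      using degree_prod_sum_le[OF fin, of P] by simp
    also have "\<dots> \<le> (\<Sum>y\<in>A. n y)" by (intro sum_mono P)
    finally show "degree (\<Prod>y\<in>A. P y) \<le> (\<Sum>y\<in>A. n y)" .
    show "poly (\<Prod>y\<in>A. P y) (node x) = 1" by (simp add: poly_prod P)
    show "poly (\<Prod>y\<in>A. P y) (node y) = 0" if "y \<in> A" for y
      using that P(3)[OF that] fin by (auto simp: poly_prod)
    show "(cmod (poly (\<Prod>y\<in>A. P y) z))\<^sup>2 \<le> (\<Prod>y\<in>A. (1 / (2 * real (n y) * torus_abs (y - x)))\<^sup>2)"
      if "cmod z = 1" for z
    proof -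
      have "(cmod (poly (\<Prod>y\<in>A. P y) z))\<^sup>2 = (\<Prod>y\<in>A. (cmod (poly (P y) z))\<^sup>2)"
        by (simp add: poly_prod prod_norm[symmetric] prod_power_distrib)
      also have "\<dots> \<le> (\<Prod>y\<in>A. (1 / (2 * real (n y) * torus_abs (y - x)))\<^sup>2)"
        by (intro prod_mono conjI P that) auto
      finally show ?thesis .
    qed
  qed
qed

text \<open>The interpolant is a product of \<open>D\<close> for the normalisation, \<open>P\<close>
  for the near points and \<open>Q\<close> for the far ones. Only \<open>D\<close> enters through
  its \<open>l2\<close> norm; \<open>P\<close> and \<open>Q\<close> enter through their sup norms by
  \<open>l2_mult_le\<close>. The bound \<open>\<alpha> \<le> \<tau>\<close> lets \<open>I\<close>
  and \<open>J\<close> exhaust the near points, and \<open>\<alpha> \<le> 1 / 4\<close> makes a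
  share of degree at least 2.\<close>

lemma local_interpolant:
  fixes X :: "torus set" and x :: torus and \<tau> :: real and m :: nat
  defines "G \<equiv> good_set x \<tau> X" and "B \<equiv> bad_set x \<tau> X"
  defines "\<nu> \<equiv> local_sparsity \<tau> G"
  defines "\<alpha> \<equiv> real (card B) / (2 * real m - 4 * real \<nu> / \<tau>)"
  defines "I \<equiv> {y \<in> X. 0 < torus_abs (y - x) \<and> torus_abs (y - x) \<le> \<alpha>}"
    and "J \<equiv> {y \<in> X. \<alpha> < torus_abs (y - x) \<and> torus_abs (y - x) \<le> \<tau>}"
  assumes fin: "finite X" and x: "x \<in> X" and \<tau>: "0 < \<tau>"
    and \<alpha>: "0 < \<alpha>" "\<alpha> \<le> \<tau>" "\<alpha> \<le> 1 / 4"
  obtains f :: "complex poly" where "\<And>j. m \<le> j \<Longrightarrow> coeff f j = 0"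
    and "poly f (node x) = 1" and "\<And>y. y \<in> X \<Longrightarrow> y \<noteq> x \<Longrightarrow> poly f (node y) = 0"
    and "(\<Sum>j<m. (cmod (coeff f j))\<^sup>2) \<le> 2 ^ \<nu> * (2 * \<alpha> / (1 - 2 * \<alpha>))
         * (\<Prod>y\<in>J. (phi (1 / (2 * torus_abs (y - x))))\<^sup>2)
         * (\<Prod>y\<in>I. \<alpha>\<^sup>2 / ((1 - 2 * \<alpha>)\<^sup>2 * (torus_abs (y - x))\<^sup>2))"
proof -
  define t where "t = (\<lambda>y. torus_abs (y - x))"
  define n0 where "n0 = nat \<lfloor>1 / (2 * \<alpha>)\<rfloor>"
  have four: "4 \<le> 1 / \<alpha>" using \<alpha> by (simp add: field_simps)
  have n0: "real n0 \<le> 1 / (2 * \<alpha>)" "1 / (2 * \<alpha>) - 1 < real n0" "1 \<le> n0"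
    using four unfolding n0_def by (auto simp: le_nat_iff le_floor_iff) linarith+
  \<comment> \<open>Rounding a share down to an integer loses less than 1, and
    \<open>1 / (2 * \<alpha>) - 1\<close> is this quotient: the origin of every
    \<open>1 - 2 * \<alpha>\<close> in the estimate.\<close>
  have n0_pos: "0 < (1 - 2 * \<alpha>) / (2 * \<alpha>)" "(1 - 2 * \<alpha>) / (2 * \<alpha>) \<le> real n0"
    using n0 \<alpha> by (auto simp: diff_divide_distrib)
  \<comment> \<open>\<open>n y\<close> is the largest degree with \<open>n y * t y \<le> 1 / 2\<close>, capped at \<open>n0\<close>.\<close>
  define n where "n = (\<lambda>y. if t y \<le> \<alpha> then n0 else nat \<lfloor>1 / (2 * t y)\<rfloor>)"
  have finIJ: "finite I" "finite J" using fin by (simp_all add: I_def J_def)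
  have disj: "I \<inter> J = {}" by (auto simp: I_def J_def)
  have xIJ: "x \<notin> I \<union> J" using \<alpha> by (auto simp: I_def J_def)
  have t_pos: "0 < t y" if "y \<in> I \<union> J" for y using that \<alpha> by (auto simp: I_def J_def t_def)
  have n_props: "0 < n y" "real (n y) * t y \<le> 1 / 2" "n y \<le> n0" if y: "y \<in> I \<union> J" for y
  proof -
    show "0 < n y" "real (n y) * t y \<le> 1 / 2" "n y \<le> n0"
    proof (atomize (full), cases "t y \<le> \<alpha>")
      case True
      have "real n0 * t y \<le> 1 / (2 * \<alpha>) * \<alpha>"
        using n0 True t_pos[OF y] \<alpha> by (intro mult_mono) auto
      then show "0 < n y \<and> real (n y) * t y \<le> 1 / 2 \<and> n y \<le> n0"
        using True n0 \<alpha> by (simp add: n_def)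
    next
      case False
      have "1 \<le> 1 / (2 * t y)"
        using torus_abs_le_half[of "y - x"] t_pos[OF y] by (simp add: t_def field_simps)
      then have "1 \<le> \<lfloor>1 / (2 * t y)\<rfloor>" by (simp add: le_floor_iff)
      moreover have "real_of_int \<lfloor>1 / (2 * t y)\<rfloor> * t y \<le> 1 / (2 * t y) * t y"
        using t_pos[OF y] by (intro mult_right_mono) auto
      moreover have "\<lfloor>1 / (2 * t y)\<rfloor> \<le> \<lfloor>1 / (2 * \<alpha>)\<rfloor>"
        using False \<alpha> by (intro floor_mono frac_le) auto
      ultimately show "0 < n y \<and> real (n y) * t y \<le> 1 / 2 \<and> n y \<le> n0"
        using False t_pos[OF y] by (simp add: n_def n0_def nat_mono)
    qed
  qed
  obtain D :: "complex poly" where D: "\<And>j. n0 \<le> j \<Longrightarrow> coeff D j = 0" "poly D (node x) = 1"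
    "\<And>m. n0 \<le> m \<Longrightarrow> (\<Sum>j<m. (cmod (coeff D j))\<^sup>2) = 1 / real n0"
    using dirichlet_poly[of n0 x] n0 by auto
  obtain P :: "complex poly" where P: "degree P \<le> (\<Sum>y\<in>I \<union> J. n y)" "poly P (node x) = 1"
    "\<And>y. y \<in> I \<union> J \<Longrightarrow> poly P (node y) = 0"
    "\<And>z. cmod z = 1 \<Longrightarrow> (cmod (poly P z))\<^sup>2 \<le> (\<Prod>y\<in>I \<union> J. (1 / (2 * real (n y) * t y))\<^sup>2)"
    using two_point_product[of "I \<union> J" n x] finIJ n_props xIJ unfolding t_def by blast
  have finG: "finite G" using fin by (simp add: G_def good_set_def)
  obtain Q :: "complex poly" where Q: "degree Q \<le> 2 * real \<nu> / \<tau>" "poly Q (node x) = 1"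
    "\<And>y. y \<in> G \<Longrightarrow> poly Q (node y) = 0"
    "\<And>z. cmod z = 1 \<Longrightarrow> (cmod (poly Q z))\<^sup>2 \<le> 2 ^ \<nu>"
    using good_set_interpolant[OF finG \<tau>, of x] unfolding \<nu>_def G_def by (auto simp: good_set_def)
  define R where "R = (\<Prod>y\<in>J. (phi (1 / (2 * torus_abs (y - x))))\<^sup>2)
         * (\<Prod>y\<in>I. \<alpha>\<^sup>2 / ((1 - 2 * \<alpha>)\<^sup>2 * (torus_abs (y - x))\<^sup>2))"
  have R_ge: "(\<Prod>y\<in>I \<union> J. (1 / (2 * real (n y) * t y))\<^sup>2) \<le> R"
  proof -
    \<comment> \<open>On \<open>J\<close> the degree is the exact floor of
      \<open>1 / (2 * t y)\<close>, so the bound of the factor equals \<open>phi\<close>. On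
      \<open>I\<close> it is capped at \<open>n0\<close>, and the lower bound for \<open>n0\<close>
      is inserted.\<close>
    have J_eq: "(1 / (2 * real (n y) * t y))\<^sup>2 = (phi (1 / (2 * torus_abs (y - x))))\<^sup>2" if "y \<in> J" for y
    proof -
      have "\<not> t y \<le> \<alpha>" using that by (simp add: J_def t_def)
      then have "real (n y) = of_int \<lfloor>1 / (2 * t y)\<rfloor>"
        using t_pos[of y] that by (simp add: n_def)
      then show ?thesis by (simp add: phi_def t_def mult_ac)
    qed
    have I_le: "(1 / (2 * real (n y) * t y))\<^sup>2 \<le> \<alpha>\<^sup>2 / ((1 - 2 * \<alpha>)\<^sup>2 * (torus_abs (y - x))\<^sup>2)" if y: "y \<in> I" for y
    proof -
      have ty: "0 < t y" using t_pos y by simp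
      have "n y = n0" using y by (simp add: I_def n_def t_def)
      moreover have "1 / (2 * real n0 * t y) \<le> 1 / (2 * ((1 - 2 * \<alpha>) / (2 * \<alpha>)) * t y)"
        using n0_pos ty by (intro frac_le mult_right_mono mult_left_mono mult_pos_pos) auto
      moreover have "\<dots> = \<alpha> / ((1 - 2 * \<alpha>) * t y)"
        using \<alpha> ty by (simp add: divide_simps)
      ultimately have "(1 / (2 * real (n y) * t y))\<^sup>2 \<le> (\<alpha> / ((1 - 2 * \<alpha>) * t y))\<^sup>2"
        using ty by (intro power_mono) auto
      then show ?thesis by (simp add: t_def power_divide power_mult_distrib)
    qed
    have "(\<Prod>y\<in>I \<union> J. (1 / (2 * real (n y) * t y))\<^sup>2)
        = (\<Prod>y\<in>J. (1 / (2 * real (n y) * t y))\<^sup>2) * (\<Prod>y\<in>I. (1 / (2 * real (n y) * t y))\<^sup>2)"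
      using finIJ disj by (simp add: prod.union_disjoint mult.commute)
    also have "(\<Prod>y\<in>J. (1 / (2 * real (n y) * t y))\<^sup>2) = (\<Prod>y\<in>J. (phi (1 / (2 * torus_abs (y - x))))\<^sup>2)"
      by (intro prod.cong J_eq refl)
    finally show ?thesis
      unfolding R_def using I_le
      by (simp only:) (intro mult_left_mono prod_mono prod_nonneg conjI; simp)
  qed
  have degree_bound: "n0 + (degree P + degree Q) \<le> m"
  proof -
    have B: "B = insert x (I \<union> J)"
      using x \<tau> \<alpha> torus_abs_diff_pos[of _ x]
      by (auto simp: B_def bad_set_def I_def J_def torus_abs_minus_commute[of x] not_le)
    have "card B = Suc (card (I \<union> J))" unfolding B using finIJ xIJ by simp
    then have card_B: "real (card B) * real n0 = real n0 + real (card (I \<union> J)) * real n0"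
      by (simp add: algebra_simps)
    \<comment> \<open>A positive quotient with a nonnegative numerator has a positive denominator,
      so \<alpha> can be solved for the total degree.\<close>
    have "0 < 2 * real m - 4 * real \<nu> / \<tau>"
      using \<alpha>(1) unfolding \<alpha>_def by (simp add: zero_less_divide_iff)
    moreover have "0 < real (card B)" using \<open>card B = Suc _\<close> by simp
    ultimately have "real (card B) * (1 / (2 * \<alpha>)) = real m - 2 * real \<nu> / \<tau>"
      unfolding \<alpha>_def by (simp add: field_simps)
    moreover have "real (card B) * real n0 \<le> real (card B) * (1 / (2 * \<alpha>))"
      using n0(1) by (rule mult_left_mono) simp
    moreover have "degree P \<le> card (I \<union> J) * n0"
      using order_trans[OF P(1) sum_bounded_above[of "I \<union> J" n n0]] n_props(3) by simp
    then have "real (degree P) \<le> real (card (I \<union> J)) * real n0"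
      by (metis of_nat_le_iff of_nat_mult)
    ultimately have "real n0 + (real (degree P) + real (degree Q)) \<le> real m"
      using Q(1) card_B by linarith
    then show ?thesis by linarith
  qed
  define f where "f = (P * Q) * D"
  \<comment> \<open>\<open>degree_bound\<close> counts the \<open>n0\<close> coefficients of
    \<open>D\<close>; its degree is one less, which gives the strict bound by
    \<open>m\<close>.\<close>
  have "degree D \<le> n0 - 1" using D(1) n0(3) by (intro degree_le) auto
  then have "degree f < m"
    using degree_mult_le[of "P * Q" D] degree_mult_le[of P Q] degree_bound n0(3) unfolding f_def by linarith
  then have coeff_f: "coeff f j = 0" if "m \<le> j" for j using that by (intro coeff_eq_0) linarith
  have sup: "(cmod (poly (P * Q) z))\<^sup>2 \<le> 2 ^ \<nu> * R" if z: "cmod z = 1" for z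
  proof -
    have "(cmod (poly (P * Q) z))\<^sup>2 = (cmod (poly Q z))\<^sup>2 * (cmod (poly P z))\<^sup>2"
      by (simp add: norm_mult power_mult_distrib)
    also have "\<dots> \<le> 2 ^ \<nu> * R"
      using Q(4)[OF z] order_trans[OF P(4)[OF z] R_ge] by (intro mult_mono) auto
    finally show ?thesis .
  qed
  have R_nonneg: "0 \<le> R" unfolding R_def by (intro mult_nonneg_nonneg prod_nonneg) auto
  show thesis
  proof
    show "poly f (node x) = 1" by (simp add: f_def D P Q)
    show "poly f (node y) = 0" if y: "y \<in> X" "y \<noteq> x" for y
    proof -
      have "y \<in> I \<union> J \<union> G"
        using y torus_abs_diff_pos[of y x] \<alpha>
        by (auto simp: I_def J_def G_def good_set_def torus_abs_minus_commute[of x])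
      then show ?thesis using P(3) Q(3) by (auto simp: f_def)
    qed
    have "(\<Sum>j<m. (cmod (coeff f j))\<^sup>2) \<le> 2 ^ \<nu> * R * (\<Sum>j<m. (cmod (coeff D j))\<^sup>2)"
      unfolding f_def
    proof (rule l2_mult_le)
      show "coeff D j = 0" if "m \<le> j" for j using that D(1) degree_bound by simp
      show "coeff (P * Q * D) j = 0" if "m \<le> j" for j using coeff_f[OF that] by (simp add: f_def)
    qed (rule sup)
    also have "\<dots> = 2 ^ \<nu> * R * (1 / real n0)" using D(3)[of m] degree_bound by simp
    also have "\<dots> \<le> 2 ^ \<nu> * R * (2 * \<alpha> / (1 - 2 * \<alpha>))"
    proof (rule mult_left_mono)
      have "1 / real n0 \<le> 1 / ((1 - 2 * \<alpha>) / (2 * \<alpha>))" using n0_pos by (intro frac_le) auto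
      then show "1 / real n0 \<le> 2 * \<alpha> / (1 - 2 * \<alpha>)" by simp
    qed (use R_nonneg in simp)
    finally show "(\<Sum>j<m. (cmod (coeff f j))\<^sup>2) \<le> 2 ^ \<nu> * (2 * \<alpha> / (1 - 2 * \<alpha>))
         * (\<Prod>y\<in>J. (phi (1 / (2 * torus_abs (y - x))))\<^sup>2)
         * (\<Prod>y\<in>I. \<alpha>\<^sup>2 / ((1 - 2 * \<alpha>)\<^sup>2 * (torus_abs (y - x))\<^sup>2))"
      unfolding R_def by (simp only: mult_ac)
  qed (rule coeff_f)
qed

section \<open>The singular value estimate\<close>

lemma local_sparsity_mono:
  assumes fin: "finite V" and sub: "U \<subseteq> V"
  shows "local_sparsity \<tau> U \<le> local_sparsity \<tau> V"
proof (cases "U = {}")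
  case False
  have finU: "finite U" using sub fin by (rule finite_subset)
  have "card {u' \<in> U. torus_abs (u - u') \<le> \<tau>} \<le> local_sparsity \<tau> V" if "u \<in> U" for u
  proof -
    have "card {u' \<in> U. torus_abs (u - u') \<le> \<tau>} \<le> card {u' \<in> V. torus_abs (u - u') \<le> \<tau>}"
      using fin sub by (intro card_mono) auto
    also have "\<dots> \<le> local_sparsity \<tau> V" using fin sub that by (intro local_sparsity_ge) auto
    finally show ?thesis .
  qed
  then show ?thesis using False finU by (simp add: local_sparsity_def[of _ U])
qed (simp add: local_sparsity_def)

text \<open>The criterion provides \<open>3 * \<nu> / \<tau>\<close> degrees, the far points take at
  most \<open>2 * \<nu> / \<tau>\<close>, and at most \<nu> near points share the rest. Hence
  \<open>\<alpha> \<le> \<tau> / 2\<close>, and \<open>\<tau> \<le> 1 / 2\<close> yields the bound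
  1/4.\<close>

lemma density_criterion_bounds:
  assumes fin: "finite X" and x: "x \<in> X" and \<tau>: "0 < \<tau>" "\<tau> \<le> 1 / 2"
    and density: "3 * real (local_sparsity \<tau> X) / \<tau> \<le> real m"
  defines "\<alpha> \<equiv> real (card (bad_set x \<tau> X)) / (2 * real m - 4 * real (local_sparsity \<tau> (good_set x \<tau> X)) / \<tau>)"
  shows "0 < \<alpha>" "\<alpha> \<le> \<tau>" "\<alpha> \<le> 1 / 4"
proof -
  define \<nu> where "\<nu> = real (local_sparsity \<tau> X)"
  define b where "b = real (card (bad_set x \<tau> X))"
  define D where "D = 2 * real m - 4 * real (local_sparsity \<tau> (good_set x \<tau> X)) / \<tau>"
  have "x \<in> bad_set x \<tau> X" "finite (bad_set x \<tau> X)" using x fin \<tau> by (simp_all add: bad_set_def)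
  then have b_pos: "0 < b" unfolding b_def by (simp add: card_gt_0_iff) blast
  have b_le: "b \<le> \<nu>" unfolding b_def \<nu>_def bad_set_def of_nat_le_iff by (rule local_sparsity_ge[OF fin x])
  have "real (local_sparsity \<tau> (good_set x \<tau> X)) \<le> \<nu>"
    unfolding \<nu>_def of_nat_le_iff using fin by (intro local_sparsity_mono) (auto simp: good_set_def)
  then have "4 * real (local_sparsity \<tau> (good_set x \<tau> X)) / \<tau> \<le> 4 * \<nu> / \<tau>"
    using \<tau> by (intro divide_right_mono) auto
  moreover have m: "3 * (\<nu> / \<tau>) \<le> real m" using density by (simp add: \<nu>_def)
  ultimately have D_ge: "2 * (\<nu> / \<tau>) \<le> D" by (simp add: D_def)
  moreover have "0 < \<nu> / \<tau>" using b_pos b_le \<tau> by simp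
  ultimately have D_pos: "0 < D" by linarith
  have \<alpha>: "\<alpha> = b / D" by (simp add: \<alpha>_def b_def D_def)
  have "2 * b \<le> D * \<tau>" using D_ge b_le \<tau> by (simp add: field_simps)
  then have "\<alpha> \<le> \<tau> / 2" using D_pos by (simp add: \<alpha> field_simps)
  then show "\<alpha> \<le> \<tau>" "\<alpha> \<le> 1 / 4" using \<tau> by simp_all
  show "0 < \<alpha>" using b_pos D_pos by (simp add: \<alpha>)
qed

lemma phi_bounds: "0 \<le> phi q" "phi q \<le> 2" if "1 \<le> q"
proof -
  have "1 \<le> \<lfloor>q\<rfloor>" using that by (simp add: le_floor_iff)
  then have f: "1 \<le> real_of_int \<lfloor>q\<rfloor>" by simp
  then show "0 \<le> phi q" using that by (simp add: phi_def)
  have "q \<le> 2 * real_of_int \<lfloor>q\<rfloor>" using f by linarith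
  then show "phi q \<le> 2" using f by (simp add: phi_def field_simps)
qed

text \<open>This compares the two forms of the estimate term by term:
  \<open>\<alpha> \<le> 1 / 4\<close> gives \<open>1 - 2 * \<alpha> \<ge> 1 / 2\<close>, and
  \<open>phi\<close> is at most 2. The factor \<open>s\<close> under the root in \<open>b\<close>
  makes each summand at most \<open>1 / (s * b^2)\<close>, so that \<open>s\<close> of them add up
  without loss.\<close>

lemma local_term_le:
  fixes I J :: "torus set" and x :: torus and s \<nu> :: nat and \<alpha> :: real
  assumes s: "0 < s" and \<alpha>: "0 < \<alpha>" "\<alpha> \<le> 1 / 4"
    and I: "\<And>y. y \<in> I \<Longrightarrow> 0 < torus_abs (y - x)" and J: "\<And>y. y \<in> J \<Longrightarrow> 0 < torus_abs (y - x)"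
  defines "b \<equiv> 1 / sqrt (4 * real s * \<alpha>) * (1 / sqrt (2 ^ \<nu>)) * (1 / 2 ^ card J)
    * (\<Prod>y\<in>I. torus_abs (y - x) / (2 * \<alpha>))"
  shows "2 ^ \<nu> * (2 * \<alpha> / (1 - 2 * \<alpha>)) * (\<Prod>y\<in>J. (phi (1 / (2 * torus_abs (y - x))))\<^sup>2)
    * (\<Prod>y\<in>I. \<alpha>\<^sup>2 / ((1 - 2 * \<alpha>)\<^sup>2 * (torus_abs (y - x))\<^sup>2)) \<le> 1 / (real s * b\<^sup>2)"
    and "0 < b"
proof -
  define t where "t = (\<lambda>y. torus_abs (y - x))"
  define T where "T = (\<Prod>y\<in>I. t y / (2 * \<alpha>))"
  have T: "0 < T" unfolding T_def t_def using I \<alpha> by (intro prod_pos) auto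
  show "0 < b" unfolding b_def using s \<alpha> T by (simp add: T_def t_def)
  have b_sq: "b\<^sup>2 = 1 / (4 * real s * \<alpha>) * (1 / 2 ^ \<nu>) * (1 / 4 ^ card J) * T\<^sup>2"
    using s \<alpha> by (simp add: b_def T_def t_def power_mult_distrib power_divide power2_eq_square[of "2 ^ card J"]
        power_mult_distrib[symmetric])
  have b2: "1 / (real s * b\<^sup>2) = 2 ^ \<nu> * (4 * \<alpha>) * 4 ^ card J * (1 / T\<^sup>2)"
    unfolding b_sq using s \<alpha> T by (simp add: field_simps)
  have quot: "2 * \<alpha> / (1 - 2 * \<alpha>) \<le> 4 * \<alpha>"
  proof -
    have "2 * \<alpha> / (1 - 2 * \<alpha>) \<le> 2 * \<alpha> / (1 / 2)" using \<alpha> by (intro frac_le) auto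
    then show ?thesis by simp
  qed
  have "(\<Prod>y\<in>J. (phi (1 / (2 * t y)))\<^sup>2) \<le> (\<Prod>y\<in>J. 2\<^sup>2)"
  proof (intro prod_mono conjI power_mono)
    fix y assume "y \<in> J"
    then have "1 \<le> 1 / (2 * t y)"
      using J torus_abs_le_half[of "y - x"] by (simp add: t_def field_simps)
    then show "phi (1 / (2 * t y)) \<le> 2" "0 \<le> phi (1 / (2 * t y))" by (rule phi_bounds)+
  qed simp
  then have J_le: "(\<Prod>y\<in>J. (phi (1 / (2 * t y)))\<^sup>2) \<le> 4 ^ card J" by simp
  have "(\<Prod>y\<in>I. \<alpha>\<^sup>2 / ((1 - 2 * \<alpha>)\<^sup>2 * (t y)\<^sup>2)) \<le> (\<Prod>y\<in>I. (1 / (t y / (2 * \<alpha>)))\<^sup>2)"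
  proof (intro prod_mono conjI)
    fix y assume "y \<in> I"
    then have ty: "0 < t y" using I by (simp add: t_def)
    have "\<alpha> / ((1 - 2 * \<alpha>) * t y) \<le> \<alpha> / (1 / 2 * t y)"
      using \<alpha> ty by (intro frac_le mult_right_mono mult_pos_pos) auto
    also have "\<dots> = 1 / (t y / (2 * \<alpha>))" by simp
    finally have "(\<alpha> / ((1 - 2 * \<alpha>) * t y))\<^sup>2 \<le> (1 / (t y / (2 * \<alpha>)))\<^sup>2"
      using \<alpha> ty by (intro power_mono) auto
    then show "\<alpha>\<^sup>2 / ((1 - 2 * \<alpha>)\<^sup>2 * (t y)\<^sup>2) \<le> (1 / (t y / (2 * \<alpha>)))\<^sup>2"
      by (simp add: power_divide power_mult_distrib)
  qed auto
  also have "\<dots> = (1 / T)\<^sup>2"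
    unfolding prod_power_distrib[symmetric] by (simp only: T_def prod_dividef prod.neutral_const)
  also have "\<dots> = 1 / T\<^sup>2" by (simp add: power_divide)
  finally have I_le: "(\<Prod>y\<in>I. \<alpha>\<^sup>2 / ((1 - 2 * \<alpha>)\<^sup>2 * (t y)\<^sup>2)) \<le> 1 / T\<^sup>2" .
  show "2 ^ \<nu> * (2 * \<alpha> / (1 - 2 * \<alpha>)) * (\<Prod>y\<in>J. (phi (1 / (2 * torus_abs (y - x))))\<^sup>2)
    * (\<Prod>y\<in>I. \<alpha>\<^sup>2 / ((1 - 2 * \<alpha>)\<^sup>2 * (torus_abs (y - x))\<^sup>2)) \<le> 1 / (real s * b\<^sup>2)"
    unfolding b2 using quot J_le I_le \<alpha>
    by (intro mult_mono) (auto simp: t_def intro!: prod_nonneg)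
qed

theorem theorem1:
  fixes m s :: nat and x :: "nat \<Rightarrow> torus" and X :: "torus set" and \<tau> :: real
    and G I J :: "nat \<Rightarrow> torus set" and \<alpha> :: "nat \<Rightarrow> real"
  assumes "s \<ge> 2" and "m \<ge> 6 * s"
    and "inj_on x {1..s}" and "X = x ` {1..s}"
    and "0 < \<tau>" and "\<tau> \<le> 1 / 2"
    and "3 * real (local_sparsity \<tau> X) / \<tau> \<le> real m"
    and "\<And>k. k \<in> {1..s} \<Longrightarrow> G k = good_set (x k) \<tau> X"
    and "\<And>k. k \<in> {1..s} \<Longrightarrow>
      \<alpha> k = real (card (bad_set (x k) \<tau> X)) / (2 * real m - 4 * real (local_sparsity \<tau> (G k)) / \<tau>)"
    and "\<And>k. k \<in> {1..s} \<Longrightarrow>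
      I k = {y \<in> X. 0 < torus_abs (y - x k) \<and> torus_abs (y - x k) \<le> \<alpha> k}"
    and "\<And>k. k \<in> {1..s} \<Longrightarrow>
      J k = {y \<in> X. \<alpha> k < torus_abs (y - x k) \<and> torus_abs (y - x k) \<le> \<tau>}"
  shows "1 / (sing_val s (fourier_matrix m s x))\<^sup>2 \<le>
      (\<Sum>k=1..s. 2 ^ local_sparsity \<tau> (G k) * (2 * \<alpha> k / (1 - 2 * \<alpha> k))
         * (\<Prod>y\<in>J k. (phi (1 / (2 * torus_abs (y - x k))))\<^sup>2)
         * (\<Prod>y\<in>I k. (\<alpha> k)\<^sup>2 / ((1 - 2 * \<alpha> k)\<^sup>2 * (torus_abs (y - x k))\<^sup>2)))
    \<and> sing_val s (fourier_matrix m s x) \<ge>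
      Min ((\<lambda>k. 1 / sqrt (4 * real s * \<alpha> k) * (1 / sqrt (2 ^ local_sparsity \<tau> (G k)))
         * (1 / 2 ^ card (J k)) * (\<Prod>y\<in>I k. torus_abs (y - x k) / (2 * \<alpha> k))) ` {1..s})"
proof -
  note s = assms(1) and inj = assms(3) and X = assms(4) and \<tau> = assms(5,6) and density = assms(7)
    and G = assms(8) and \<alpha>_eq = assms(9) and I = assms(10) and J = assms(11)
  define \<sigma> where "\<sigma> = sing_val s (fourier_matrix m s x)"
  define \<nu> where "\<nu> = (\<lambda>k. local_sparsity \<tau> (G k))"
  define S where "S = (\<lambda>k. 2 ^ \<nu> k * (2 * \<alpha> k / (1 - 2 * \<alpha> k))
         * (\<Prod>y\<in>J k. (phi (1 / (2 * torus_abs (y - x k))))\<^sup>2)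
         * (\<Prod>y\<in>I k. (\<alpha> k)\<^sup>2 / ((1 - 2 * \<alpha> k)\<^sup>2 * (torus_abs (y - x k))\<^sup>2)))"
  define b where "b = (\<lambda>k. 1 / sqrt (4 * real s * \<alpha> k) * (1 / sqrt (2 ^ \<nu> k))
         * (1 / 2 ^ card (J k)) * (\<Prod>y\<in>I k. torus_abs (y - x k) / (2 * \<alpha> k)))"
  have fin: "finite X" by (simp add: X)
  have xX: "x k \<in> X" if "k \<in> {1..s}" for k using that by (simp add: X)
  have \<alpha>: "0 < \<alpha> k" "\<alpha> k \<le> \<tau>" "\<alpha> k \<le> 1 / 4" if k: "k \<in> {1..s}" for k
    using density_criterion_bounds[OF fin xX[OF k] \<tau> density] unfolding \<alpha>_eq[OF k] G[OF k] by simp_all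
  have "\<exists>f :: complex poly. (\<forall>j\<ge>m. coeff f j = 0) \<and> poly f (node (x k)) = 1
      \<and> (\<forall>y\<in>X. y \<noteq> x k \<longrightarrow> poly f (node y) = 0) \<and> (\<Sum>j<m. (cmod (coeff f j))\<^sup>2) \<le> S k"
    if k: "k \<in> {1..s}" for k
  proof -
    note loc = local_interpolant[OF fin xX[OF k] \<tau>(1), of m, folded G[OF k], folded \<alpha>_eq[OF k], OF \<alpha>[OF k],
        folded I[OF k] J[OF k] \<nu>_def]
    obtain g :: "complex poly" where "\<And>j. m \<le> j \<Longrightarrow> coeff g j = 0" "poly g (node (x k)) = 1"
      "\<And>y. y \<in> X \<Longrightarrow> y \<noteq> x k \<Longrightarrow> poly g (node y) = 0" "(\<Sum>j<m. (cmod (coeff g j))\<^sup>2) \<le> S k"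
      unfolding S_def \<nu>_def by (rule loc) blast
    then show ?thesis by blast
  qed
  then have "\<exists>f :: nat \<Rightarrow> complex poly. \<forall>k\<in>{1..s}. (\<forall>j\<ge>m. coeff (f k) j = 0) \<and> poly (f k) (node (x k)) = 1
      \<and> (\<forall>y\<in>X. y \<noteq> x k \<longrightarrow> poly (f k) (node y) = 0) \<and> (\<Sum>j<m. (cmod (coeff (f k) j))\<^sup>2) \<le> S k"
    by (intro bchoice ballI)
  then obtain f :: "nat \<Rightarrow> complex poly" where f: "\<And>k j. k \<in> {1..s} \<Longrightarrow> m \<le> j \<Longrightarrow> coeff (f k) j = 0"
    "\<And>k. k \<in> {1..s} \<Longrightarrow> poly (f k) (node (x k)) = 1"
    "\<And>k y. k \<in> {1..s} \<Longrightarrow> y \<in> X \<Longrightarrow> y \<noteq> x k \<Longrightarrow> poly (f k) (node y) = 0"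
    "\<And>k. k \<in> {1..s} \<Longrightarrow> (\<Sum>j<m. (cmod (coeff (f k) j))\<^sup>2) \<le> S k"
    by blast
  have interp: "poly (f k) (node (x l)) = (if k = l then 1 else 0)" if "k \<in> {1..s}" "l \<in> {1..s}" for k l
    using that f(2)[of k] f(3)[of k "x l"] xX[of l] inj by (auto simp: inj_on_eq_iff)
  have s1: "1 \<le> s" using s by simp
  \<comment> \<open>Positivity rules out the convention \<open>1 / 0 = 0\<close>, so that the
    comparison of reciprocals at the end can be inverted.\<close>
  have \<sigma>_pos: "0 < \<sigma>" unfolding \<sigma>_def by (rule sing_val_lower_bound(1)[OF s1 f(1) interp])
  have "1 / \<sigma>\<^sup>2 \<le> (\<Sum>k=1..s. \<Sum>j<m. (cmod (coeff (f k) j))\<^sup>2)"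
    unfolding \<sigma>_def by (rule sing_val_lower_bound(2)[OF s1 f(1) interp])
  also have "\<dots> \<le> (\<Sum>k=1..s. S k)" by (intro sum_mono f(4))
  finally have first: "1 / \<sigma>\<^sup>2 \<le> (\<Sum>k=1..s. S k)" .
  define M where "M = Min (b ` {1..s})"
  have S_le: "S k \<le> 1 / (real s * (b k)\<^sup>2)" and b_pos: "0 < b k" if k: "k \<in> {1..s}" for k
    unfolding S_def b_def using s1 \<alpha>[OF k] I[OF k] J[OF k]
    by (intro local_term_le; simp)+
  have M_le: "M \<le> b k" if "k \<in> {1..s}" for k unfolding M_def using that by (intro Min_le) auto
  have "M \<in> b ` {1..s}" unfolding M_def using s1 by (intro Min_in) auto
  then have M_pos: "0 < M" using b_pos by auto
  \<comment> \<open>Replacing every \<open>b k\<close> by the minimum \<open>M\<close> makes the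
    \<open>s\<close> bounds equal, and the weight \<open>1 / s\<close> in each turns their sum into
    \<open>1 / M^2\<close>.\<close>
  have "(\<Sum>k=1..s. S k) \<le> (\<Sum>k=1..s. 1 / (real s * M\<^sup>2))"
  proof (rule sum_mono)
    fix k assume k: "k \<in> {1..s}"
    have "1 / (real s * (b k)\<^sup>2) \<le> 1 / (real s * M\<^sup>2)"
      using M_le[OF k] M_pos s1 by (intro frac_le mult_left_mono power_mono) auto
    with S_le[OF k] show "S k \<le> 1 / (real s * M\<^sup>2)" by linarith
  qed
  also have "\<dots> = 1 / M\<^sup>2" using s1 by simp
  finally have "1 / \<sigma>\<^sup>2 \<le> 1 / M\<^sup>2" using first by linarith
  then have "M\<^sup>2 \<le> \<sigma>\<^sup>2" using M_pos \<sigma>_pos by (simp add: field_simps)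
  then have "M \<le> \<sigma>" by (rule power2_le_imp_le) (use \<sigma>_pos in simp)
  show ?thesis
    using first \<open>M \<le> \<sigma>\<close> unfolding S_def M_def b_def \<sigma>_def \<nu>_def by (rule conjI)
qed

end
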